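(* Let $X$ be a simplicial complex, let $w:X\to\mathbb{R}_{>0}$, and let $0\le\ell<k\le\dim(X)$. Then, for all $1\le i\le|X(k)|$, \[ (k-\ell)\cdot\lambda_i\big(L_k(X;w)\big)\ge (k+1)\cdot\lambda_i\Big(\bigoplus_{\substack{\eta\in X(\ell):\\ \dim(\mathrm{lk}(X,\eta))\ge k-\ell-1}} L_{k-\ell-1}(\mathrm{lk}(X,\eta);w_\eta)\Big)-(\ell+1)\Delta_k(X;w). \]
   Context: A simplicial complex $X$ on a finite vertex set $V$ is a family of subsets of $V$ closed under taking subsets (it contains $\emptyset$); $X(k)$ is the set of its $k$-dimensional faces (faces of size $k+1$), so $X(-1)=\{\emptyset\}$. Fix a linear order $<$ on $V$. For $\sigma\in X(k-1)$, $\tau\in X(k)$ with $\sigma\subset\tau$, let $(\tau:\sigma)=(-1)^{|\{v\in\tau:\,v<u\}|}$, where $u$ is the unique vertex of $\tau\setminus\sigma$. The boundary matrix $\partial_k(X)\in\mathbb{R}^{X(k-1)\times X(k)}$ has $(\sigma,\tau)$-entry $(\tau:\sigma)$ if $\sigma\subset\tau$ and $0$ otherwise. For $w:X\to\mathbb{R}_{>0}$, $W_k(X)$ is the diagonal matrix indexed by $X(k)$ with entries $w(\sigma)$. For $0\le k\le\dim X-1$, $L^+_k(X;w)=W_k(X)^{-1}\partial_{k+1}(X)W_{k+1}(X)\partial_{k+1}(X)^T$, and $L^+_{\dim X}(X;w)=0$. For $0\le k\le\dim X$, $L^-_k(X;w)=\partial_k(X)^TW_{k-1}(X)^{-1}\partial_k(X)W_k(X)$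 and $L_k(X;w)=L_k^+(X;w)+L_k^-(X;w)$; these are diagonalizable with real nonnegative eigenvalues. The link of $\eta\in X$ is $\mathrm{lk}(X,\eta)=\{\tau\in X:\,\tau\cap\eta=\emptyset,\ \tau\cup\eta\in X\}$ (a simplicial complex with the induced vertex order), with weight function $w_\eta(\sigma)=w(\sigma\cup\eta)$. For $\sigma\in X$, $N_X(\sigma)=\{v\in V\setminus\sigma:\,\sigma\cup\{v\}\in X\}$, and $\Delta_k(X;w)=\max_{\sigma\in X(k)}\sum_{v\in N_X(\sigma)}\frac{w(\sigma\cup\{v\})}{w(\sigma)}$. $\lambda_i(M)$ denotes the $i$-th smallest eigenvalue (with multiplicity) and $\bigoplus$ the block-diagonal direct sum. *)

theory Defs
  imports "Jordan_Normal_Form.Char_Poly" "HOL-Library.Multiset"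
begin

definition simplicial_complex :: "'a set \<Rightarrow> 'a set set \<Rightarrow> bool" where
  "simplicial_complex V X \<longleftrightarrow>
     finite V \<and> X \<subseteq> Pow V \<and> {} \<in> X \<and> (\<forall>\<tau>\<in>X. \<forall>\<sigma>. \<sigma> \<subseteq> \<tau> \<longrightarrow> \<sigma> \<in> X)"

text \<open>Dimensions are integers, so that \<open>faces X (-1) = {{}}\<close> and \<open>complex_dim {{}} = -1\<close>.\<close>

definition faces :: "'a set set \<Rightarrow> int \<Rightarrow> 'a set set" where
  "faces X k = {\<sigma>\<in>X. int (card \<sigma>) = k + 1}"

definition complex_dim :: "'a set set \<Rightarrow> int" where
  "complex_dim X = int (Max (card ` X)) - 1"

definition link :: "'a set set \<Rightarrow> 'a set \<Rightarrow> 'a set set" where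
  "link X \<eta> = {\<tau>\<in>X. \<tau> \<inter> \<eta> = {} \<and> \<tau> \<union> \<eta> \<in> X}"

definition link_weight :: "('a set \<Rightarrow> real) \<Rightarrow> 'a set \<Rightarrow> 'a set \<Rightarrow> real" where
  "link_weight w \<eta> \<sigma> = w (\<sigma> \<union> \<eta>)"

definition neighbours :: "'a set \<Rightarrow> 'a set set \<Rightarrow> 'a set \<Rightarrow> 'a set" where
  "neighbours V X \<sigma> = {v \<in> V - \<sigma>. \<sigma> \<union> {v} \<in> X}"

definition max_degree :: "'a set \<Rightarrow> 'a set set \<Rightarrow> ('a set \<Rightarrow> real) \<Rightarrow> int \<Rightarrow> real" where
  "max_degree V X w k =
     Max ((\<lambda>\<sigma>. \<Sum>v\<in>neighbours V X \<sigma>. w (\<sigma> \<union> {v}) / w \<sigma>) ` faces X k)"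

text \<open>
  Matrices indexed by a finite set of faces become matrices indexed by \<open>{0..<n}\<close> through
  a fixed but arbitrary enumeration of that set. A different enumeration conjugates the
  Laplacians by a permutation matrix and does not change their eigenvalues.
\<close>

definition enum_list :: "'b set \<Rightarrow> 'b list" where
  "enum_list S = (SOME xs. distinct xs \<and> set xs = S)"

lemma enum_list:
  assumes "finite S"
  shows "distinct (enum_list S)" "set (enum_list S) = S" "length (enum_list S) = card S"
proof -
  have "\<exists>xs. distinct xs \<and> set xs = S"
    using finite_distinct_list[OF assms] by blast
  then have *: "distinct (enum_list S) \<and> set (enum_list S) = S"
    unfolding enum_list_def by (rule someI_ex)
  then show "distinct (enum_list S)" "set (enum_list S) = S" by auto
  then show "length (enum_list S) = card S" by (metis distinct_card)
qed

definition incidence_sign :: "'a::linorder set \<Rightarrow> 'a set \<Rightarrow> real" where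
  "incidence_sign \<tau> \<sigma> = (- 1) ^ card {v\<in>\<tau>. v < the_elem (\<tau> - \<sigma>)}"

definition boundary_mat :: "'a::linorder set set \<Rightarrow> int \<Rightarrow> real mat" where
  "boundary_mat X k = mat (card (faces X (k - 1))) (card (faces X k))
     (\<lambda>(i, j). let \<sigma> = enum_list (faces X (k - 1)) ! i; \<tau> = enum_list (faces X k) ! j
              in if \<sigma> \<subset> \<tau> then incidence_sign \<tau> \<sigma> else 0)"

definition weight_mat :: "'a set set \<Rightarrow> ('a set \<Rightarrow> real) \<Rightarrow> int \<Rightarrow> real mat" where
  "weight_mat X w k = mat_diag (card (faces X k)) (\<lambda>i. w (enum_list (faces X k) ! i))"

definition weight_mat_inv :: "'a set set \<Rightarrow> ('a set \<Rightarrow> real) \<Rightarrow> int \<Rightarrow> real mat" where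
  "weight_mat_inv X w k = mat_diag (card (faces X k)) (\<lambda>i. inverse (w (enum_list (faces X k) ! i)))"

lemma weight_mat_inv:
  assumes "simplicial_complex V X" "\<And>\<sigma>. \<sigma> \<in> X \<Longrightarrow> w \<sigma> > 0"
  shows "inverts_mat (weight_mat X w k) (weight_mat_inv X w k)"
    and "inverts_mat (weight_mat_inv X w k) (weight_mat X w k)"
proof -
  have "finite X"
    using assms(1) unfolding simplicial_complex_def by (meson finite_Pow_iff finite_subset)
  then have fin: "finite (faces X k)" unfolding faces_def by simp
  have nz: "w (enum_list (faces X k) ! i) \<noteq> 0" if "i < card (faces X k)" for i
  proof -
    have "enum_list (faces X k) ! i \<in> faces X k"
      using enum_list(2,3)[OF fin] that by (metis nth_mem)
    then have "enum_list (faces X k) ! i \<in> X" unfolding faces_def by simp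
    then show ?thesis using assms(2) by fastforce
  qed
  show "inverts_mat (weight_mat X w k) (weight_mat_inv X w k)"
    and "inverts_mat (weight_mat_inv X w k) (weight_mat X w k)"
    unfolding inverts_mat_def weight_mat_def weight_mat_inv_def mat_diag_diag
    using nz by (auto simp: mat_diag_def)
qed

definition upper_laplacian :: "'a::linorder set set \<Rightarrow> ('a set \<Rightarrow> real) \<Rightarrow> int \<Rightarrow> real mat" where
  "upper_laplacian X w k =
     (if k < complex_dim X
      then weight_mat_inv X w k * boundary_mat X (k + 1) * weight_mat X w (k + 1)
             * transpose_mat (boundary_mat X (k + 1))
      else 0\<^sub>m (card (faces X k)) (card (faces X k)))"

definition lower_laplacian :: "'a::linorder set set \<Rightarrow> ('a set \<Rightarrow> real) \<Rightarrow> int \<Rightarrow> real mat" where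
  "lower_laplacian X w k =
     transpose_mat (boundary_mat X k) * weight_mat_inv X w (k - 1) * boundary_mat X k
       * weight_mat X w k"

definition laplacian :: "'a::linorder set set \<Rightarrow> ('a set \<Rightarrow> real) \<Rightarrow> int \<Rightarrow> real mat" where
  "laplacian X w k = upper_laplacian X w k + lower_laplacian X w k"

text \<open>
  The \<open>i\<close>-th smallest eigenvalue, counted from \<open>i = 1\<close>, with algebraic multiplicity. For a
  matrix that is diagonalizable over the reals this is also the geometric multiplicity, and
  all \<open>dim_row A\<close> eigenvalues occur among the real roots of the characteristic polynomial.
\<close>

definition nth_eigenvalue :: "real mat \<Rightarrow> nat \<Rightarrow> real" where
  "nth_eigenvalue A i = sorted_list_of_multiset (proots (char_poly A)) ! (i - 1)"

definition link_laplacian_sum ::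
  "'a::linorder set set \<Rightarrow> ('a set \<Rightarrow> real) \<Rightarrow> int \<Rightarrow> int \<Rightarrow> real mat" where
  "link_laplacian_sum X w l k =
     diag_block_mat (map (\<lambda>\<eta>. laplacian (link X \<eta>) (link_weight w \<eta>) (k - l - 1))
       (enum_list {\<eta> \<in> faces X l. complex_dim (link X \<eta>) \<ge> k - l - 1}))"

end

theory Submission
  imports Defs "Jordan_Normal_Form.Schur_Decomposition"
begin

text \<open>
  For a function \<open>f\<close> on \<open>X(k)\<close> and a face \<open>\<eta>\<close> in \<open>X(l)\<close> let \<open>f\<^sub>\<eta>(\<sigma>) = \<plusminus>f(\<sigma> \<union> \<eta>)\<close> on the
  \<open>(k-l-1)\<close>-faces of the link of \<open>\<eta>\<close>. Counting the subsets \<open>\<eta>\<close> of a face gives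
  \<open>\<Sum>\<^sub>\<eta> |f\<^sub>\<eta>|\<^sup>2 = C(k+1, l+1) |f|\<^sup>2\<close>, and for the quadratic forms
  \<open>\<Sum>\<^sub>\<eta> \<langle>L f\<^sub>\<eta>, f\<^sub>\<eta>\<rangle> = C(k, l+1) \<langle>L\<^sub>k f, f\<rangle> + C(k, l) \<Sum>\<^sub>\<sigma> f(\<sigma>)\<^sup>2 \<Sum>\<^sub>v w(\<sigma> \<union> {v})\<close>;
  the last sum is at most \<open>\<Delta>\<^sub>k |f|\<^sup>2\<close>. Since \<open>f \<mapsto> (f\<^sub>\<eta>)\<close> is an isometric embedding up to
  scaling, the min-max principle compares the \<open>i\<close>-th eigenvalues, and dividing by
  \<open>C(k+1, l+1)\<close> gives the theorem.
\<close>

section \<open>Spectral theory of self-adjoint kernels\<close>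

text \<open>The Laplacians are not symmetric matrices. They are self-adjoint for the inner product
  weighted by \<open>w\<close>, and the spectral part assumes only this, in the form
  \<open>d r * A(r, s) = d s * A(s, r)\<close> with positive \<open>d\<close>. Eigenvalues are read
  off the characteristic polynomial, so a basis of eigenvectors has to be matched with its sorted
  roots, multiplicities included; a Schur form with prescribed diagonal achieves this. The term with
  \<Delta> has a single origin. Two distinct vertices of a (k+1)-face are both avoided by C(k, l+1)
  of its l-faces, but one vertex is avoided by C(k+1, l+1) = C(k, l+1) + C(k, l) of them; the
  surplus C(k, l) falls on the squares of the values of f. The lower Laplacian has no surplus, since
  a face \<rho> of the link of \<eta> has the same neighbours there as \<rho> \<union> \<eta> has in
  X. The constants of the theorem are the quotients C(k, l+1) / C(k+1, l+1) = (k-l) / (k+1) and C(k,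
  l) / C(k+1, l+1) = (l+1) / (k+1).\<close>

text \<open>The complex roots are real by the usual argument, for the inner product weighted by
  \<open>d\<close>: the form \<open>H\<close> of an eigenvector equals \<open>a * N\<close> with
  \<open>N\<close> a nonzero real number, and the symmetry hypothesis shows that conjugation fixes
  \<open>H\<close>.\<close>

lemma char_poly_splits_real:
  fixes A :: "real mat" and d :: "nat \<Rightarrow> real"
  assumes A: "A \<in> carrier_mat n n"
    and pos: "\<And>r. r < n \<Longrightarrow> d r > 0"
    and sym: "\<And>r s. r < n \<Longrightarrow> s < n \<Longrightarrow> d r * A $$ (r, s) = d s * A $$ (s, r)"
  shows "\<exists>es. sorted es \<and> length es = n \<and> char_poly A = (\<Prod>e\<leftarrow>es. [:- e, 1:])"
proof -
  let ?c = complex_of_real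
  let ?A = "map_mat ?c A"
  have cA: "?A \<in> carrier_mat n n" using A by simp
  obtain as where as: "char_poly ?A = (\<Prod>a\<leftarrow>as. [:- a, 1:])" and len: "length as = n"
    using char_poly_factorized[OF cA] by auto
  have real: "a \<in> \<real>" if "a \<in> set as" for a
  proof -
    have "poly (char_poly ?A) a = 0"
      unfolding as poly_prod_list using that by (auto simp: prod_list_zero_iff o_def image_iff)
    then obtain v where v: "eigenvector ?A v a"
      using eigenvalue_root_char_poly[OF cA] unfolding eigenvalue_def by blast
    then have vn: "v \<in> carrier_vec n" and v0: "v \<noteq> 0\<^sub>v n" and ev: "?A *\<^sub>v v = a \<cdot>\<^sub>v v"
      using cA unfolding eigenvector_def by auto
    have ev': "(\<Sum>s<n. ?c (A $$ (r, s)) * v $ s) = a * v $ r" if "r < n" for r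
    proof -
      have "(?A *\<^sub>v v) $ r = (\<Sum>s<n. ?c (A $$ (r, s)) * v $ s)"
        using that A vn by (auto simp: scalar_prod_def lessThan_atLeast0 intro!: sum.cong)
      then show ?thesis using ev that vn by simp
    qed
    define H where "H = (\<Sum>r<n. \<Sum>s<n. ?c (d r * A $$ (r, s)) * (cnj (v $ r) * v $ s))"
    define N where "N = (\<Sum>r<n. d r * (cmod (v $ r))\<^sup>2)"
    have "H = (\<Sum>r<n. ?c (d r) * cnj (v $ r) * (\<Sum>s<n. ?c (A $$ (r, s)) * v $ s))"
      unfolding H_def by (simp add: sum_distrib_left mult_ac)
    also have "\<dots> = (\<Sum>r<n. ?c (d r) * cnj (v $ r) * (a * v $ r))"
      using ev' by simp
    also have "\<dots> = a * ?c N"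
      unfolding N_def by (simp add: sum_distrib_left mult_ac complex_norm_square flip: of_real_power)
    finally have HN: "H = a * ?c N" .
    have "cnj H = (\<Sum>r<n. \<Sum>s<n. ?c (d r * A $$ (r, s)) * (v $ r * cnj (v $ s)))"
      unfolding H_def by simp
    also have "\<dots> = (\<Sum>s<n. \<Sum>r<n. ?c (d r * A $$ (r, s)) * (v $ r * cnj (v $ s)))"
      by (rule sum.swap)
    also have "\<dots> = H"
      unfolding H_def by (intro sum.cong refl) (simp only: sym lessThan_iff mult_ac)
    finally have "cnj H = H" .
    then have eq: "cnj a * ?c N = a * ?c N" using HN by simp
    obtain r where r: "r < n" "v $ r \<noteq> 0"
      using v0 vn by (metis carrier_vecD eq_vecI index_zero_vec)
    have "N \<noteq> 0"
    proof
      assume "N = 0"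
      then have "d r * (cmod (v $ r))\<^sup>2 = 0"
        unfolding N_def using r(1) pos[THEN less_imp_le]
        by (subst (asm) sum_nonneg_eq_0_iff) auto
      then show False using r pos[of r] by simp
    qed
    then have "cnj a = a" using eq by simp
    then show ?thesis by (simp add: Reals_cnj_iff)
  qed
  \<comment> \<open>Sorting only permutes the factors; it aligns the roots with the sorted list
    behind \<open>nth_eigenvalue\<close>.\<close>
  define es where "es = sort (map Re as)"
  interpret p: map_poly_inj_comm_ring_hom ?c ..
  have "map ?c (map Re as) = as"
    unfolding map_map using real by (intro map_idI) simp
  then have "char_poly ?A = (\<Prod>a\<leftarrow>map ?c (map Re as). [:- a, 1:])"
    unfolding as by simp
  also have "\<dots> = map_poly ?c (\<Prod>e\<leftarrow>map Re as. [:- e, 1:])"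
    unfolding p.hom_prod_list by (simp add: o_def)
  also have "(\<Prod>e\<leftarrow>map Re as. [:- e, 1:]) = (\<Prod>e\<leftarrow>es. [:- e, 1:])"
    unfolding es_def prod_mset_prod_list[symmetric] mset_map mset_sort ..
  finally have "map_poly ?c (char_poly A) = map_poly ?c (\<Prod>e\<leftarrow>es. [:- e, 1:])"
    unfolding of_real_hom.char_poly_hom[OF A] .
  then have "char_poly A = (\<Prod>e\<leftarrow>es. [:- e, 1:])" by simp
  then show ?thesis using len by (intro exI[of _ es]) (simp add: es_def)
qed

lemma nth_eigenvalue_eq_nth:
  assumes "sorted es" "char_poly A = (\<Prod>e\<leftarrow>es. [:- e, 1:])"
  shows "nth_eigenvalue A i = es ! (i - 1)"
proof -
  have "proots (\<Prod>e\<leftarrow>es. [:- e, 1:]) = mset es"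
  proof (induction es)
    case (Cons e es)
    have "(\<Prod>e\<leftarrow>es. [:- e, 1:]) \<noteq> 0"
      by (auto simp: prod_list_zero_iff)
    then have "proots ([:- e, 1:] * (\<Prod>e\<leftarrow>es. [:- e, 1:])) = proots [:- e, 1:] + proots (\<Prod>e\<leftarrow>es. [:- e, 1:])"
      by (intro proots_mult) auto
    also have "\<dots> = mset (e # es)" by (simp only: Cons.IH proots_linear_factor) simp
    finally show ?case by (simp only: list.map prod_list.Cons)
  qed simp
  then show ?thesis
    unfolding nth_eigenvalue_def assms(2)
    using assms(1) by (simp add: sorted_sort_id)
qed

text \<open>The Schur form \<open>A * P = P * B\<close> has \<open>es\<close> on the diagonal of
  \<open>B\<close>, in order and with multiplicity, so eigenspaces need no separate treatment.
  Orthonormalizing the columns of \<open>P\<close> for the weight \<open>d\<close> preserves the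
  flag that they span, hence the triangular shape and its diagonal; a self-adjoint operator that is
  triangular in an orthonormal basis is diagonal.\<close>

lemma orthonormal_eigenvectors:
  fixes A :: "real mat" and d :: "nat \<Rightarrow> real"
  assumes A: "A \<in> carrier_mat n n"
    and pos: "\<And>r. r < n \<Longrightarrow> d r > 0"
    and sym: "\<And>r s. r < n \<Longrightarrow> s < n \<Longrightarrow> d r * A $$ (r, s) = d s * A $$ (s, r)"
    and char: "char_poly A = (\<Prod>e\<leftarrow>es. [:- e, 1:])"
  shows "\<exists>u. (\<forall>i<n. \<forall>j<n. (\<Sum>r<n. d r * u i r * u j r) = (if i = j then 1 else 0)) \<and>
             (\<forall>j<n. \<forall>r<n. (\<Sum>s<n. A $$ (r, s) * u j s) = es ! j * u j r)"
proof -
  obtain B P Q where "schur_decomposition A es = (B, P, Q)"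
    by (cases "schur_decomposition A es") auto
  from schur_decomposition[OF A char this]
  have sim: "similar_mat_wit A B P Q" and ut: "upper_triangular B" and dg: "diag_mat B = es"
    by auto
  from similar_mat_witD2[OF A sim] have QP: "Q * P = 1\<^sub>m n" and APBQ: "A = P * B * Q"
    and B: "B \<in> carrier_mat n n" and P: "P \<in> carrier_mat n n" and Q: "Q \<in> carrier_mat n n"
    by auto
  have AP: "A * P = P * B"
    unfolding APBQ using B P Q QP by (simp add: assoc_mult_mat[of _ n n _ n _ n])
  have es: "B $$ (j, j) = es ! j" if "j < n" for j
    using that B dg by (auto simp: diag_mat_def)
  have QP': "(\<Sum>r<n. Q $$ (i, r) * P $$ (r, j)) = (if i = j then 1 else 0)" if "i < n" "j < n" for i j
    using arg_cong[OF QP, of "\<lambda>M. M $$ (i, j)"] that P Q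
    by (simp add: scalar_prod_def lessThan_atLeast0)
  have AP': "(\<Sum>s<n. A $$ (r, s) * P $$ (s, j)) = es ! j * P $$ (r, j) + (\<Sum>c<j. B $$ (c, j) * P $$ (r, c))"
    if "r < n" "j < n" for r j
  proof -
    have "(\<Sum>s<n. A $$ (r, s) * P $$ (s, j)) = (\<Sum>c<n. P $$ (r, c) * B $$ (c, j))"
      using arg_cong[OF AP, of "\<lambda>M. M $$ (r, j)"] that P A B
      by (simp add: scalar_prod_def lessThan_atLeast0)
    also have "\<dots> = (\<Sum>c<Suc j. P $$ (r, c) * B $$ (c, j))"
      using that ut B by (intro sum.mono_neutral_right) (auto simp: upper_triangular_def not_less)
    finally show ?thesis using es that by (simp add: mult.commute)
  qed
  txt \<open>Gram--Schmidt on the columns of \<open>P\<close>. The third conjunct keeps \<open>u\<close> inside the span of the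
    first \<open>m\<close> columns, so that the next orthogonalized column is nonzero.\<close>
  have "\<exists>u. (\<forall>i<m. \<forall>j<m. (\<Sum>r<n. d r * u i r * u j r) = (if i = j then 1 else 0)) \<and>
            (\<forall>j<m. \<forall>r<n. (\<Sum>s<n. A $$ (r, s) * u j s) = es ! j * u j r) \<and>
            (\<forall>j<m. \<forall>i\<in>{m..<n}. (\<Sum>r<n. Q $$ (i, r) * u j r) = 0) \<and>
            (\<forall>c<m. \<exists>a. \<forall>r<n. P $$ (r, c) = (\<Sum>j<m. a j * u j r))" if "m \<le> n" for m
    using that
  proof (induction m)
    case 0
    then show ?case by simp
  next
    case (Suc m)
    then have m: "m < n" by simp
    from Suc obtain u where
      orth: "\<And>i j. i < m \<Longrightarrow> j < m \<Longrightarrow> (\<Sum>r<n. d r * u i r * u j r) = (if i = j then 1 else 0)"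
      and eig: "\<And>j r. j < m \<Longrightarrow> r < n \<Longrightarrow> (\<Sum>s<n. A $$ (r, s) * u j s) = es ! j * u j r"
      and Qu: "\<And>i j. j < m \<Longrightarrow> m \<le> i \<Longrightarrow> i < n \<Longrightarrow> (\<Sum>r<n. Q $$ (i, r) * u j r) = 0"
      and span: "\<And>c. c < m \<Longrightarrow> \<exists>a. \<forall>r<n. P $$ (r, c) = (\<Sum>j<m. a j * u j r)"
      by force
    from span obtain a where
      a: "\<And>c r. c < m \<Longrightarrow> r < n \<Longrightarrow> P $$ (r, c) = (\<Sum>j<m. a c j * u j r)"
      by metis
    define t where "t j = (\<Sum>r<n. d r * u j r * P $$ (r, m))" for j
    define v where "v r = P $$ (r, m) - (\<Sum>j<m. t j * u j r)" for r
    have vu: "(\<Sum>r<n. d r * u i r * v r) = 0" if i: "i < m" for i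
    proof -
      have "(\<Sum>r<n. d r * u i r * v r)
          = t i - (\<Sum>r<n. \<Sum>j<m. t j * (d r * u i r * u j r))"
        unfolding v_def t_def by (simp add: algebra_simps sum_subtractf sum_distrib_left)
      also have "(\<Sum>r<n. \<Sum>j<m. t j * (d r * u i r * u j r))
          = (\<Sum>j<m. t j * (\<Sum>r<n. d r * u i r * u j r))"
        by (subst sum.swap) (simp add: sum_distrib_left)
      also have "\<dots> = (\<Sum>j<m. if j = i then t i else 0)"
        using i orth by (intro sum.cong) auto
      also have "\<dots> = t i" using i by simp
      finally show ?thesis by simp
    qed
    \<comment> \<open>Coordinates of A v - \<open>es ! m\<close> v along the earlier vectors
      \<open>u j\<close>. The three terms come from the entries of \<open>B\<close> above the
      diagonal, from rewriting column \<open>m\<close> of \<open>P\<close> in terms of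
      \<open>v\<close>, and from applying \<open>A\<close> to the subtracted vectors.\<close>
    define b where "b j = (\<Sum>c<m. B $$ (c, m) * a c j) + es ! m * t j - t j * es ! j" for j
    have Av: "(\<Sum>s<n. A $$ (r, s) * v s) = es ! m * v r + (\<Sum>j<m. b j * u j r)" if r: "r < n" for r
    proof -
      have "(\<Sum>s<n. A $$ (r, s) * v s)
         = (\<Sum>s<n. A $$ (r, s) * P $$ (s, m)) - (\<Sum>s<n. \<Sum>j<m. t j * (A $$ (r, s) * u j s))"
        unfolding v_def by (simp add: algebra_simps sum_subtractf sum_distrib_left)
      also have "(\<Sum>s<n. \<Sum>j<m. t j * (A $$ (r, s) * u j s)) = (\<Sum>j<m. t j * (es ! j * u j r))"
        by (subst sum.swap) (simp add: eig r flip: sum_distrib_left)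
      also have "(\<Sum>s<n. A $$ (r, s) * P $$ (s, m))
          = es ! m * P $$ (r, m) + (\<Sum>c<m. B $$ (c, m) * (\<Sum>j<m. a c j * u j r))"
        using AP'[OF r m] a r by simp
      also have "(\<Sum>c<m. B $$ (c, m) * (\<Sum>j<m. a c j * u j r))
          = (\<Sum>j<m. (\<Sum>c<m. B $$ (c, m) * a c j) * u j r)"
        by (simp add: sum_distrib_left sum_distrib_right mult.assoc) (rule sum.swap)
      finally show ?thesis
        unfolding v_def b_def
        by (simp add: algebra_simps sum_subtractf sum.distrib sum_distrib_left)
    qed
    txt \<open>Self-adjointness kills the strictly upper triangular part.\<close>
    have b0: "b i = 0" if i: "i < m" for i
    proof -
      have "(\<Sum>r<n. d r * u i r * (\<Sum>s<n. A $$ (r, s) * v s))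
          = (\<Sum>r<n. \<Sum>s<n. (d r * A $$ (r, s)) * u i r * v s)"
        by (simp add: sum_distrib_left mult_ac)
      also have "\<dots> = (\<Sum>s<n. \<Sum>r<n. (d s * A $$ (s, r)) * u i r * v s)"
        by (subst sum.swap) (intro sum.cong refl, simp add: sym)
      also have "\<dots> = (\<Sum>s<n. d s * v s * (\<Sum>r<n. A $$ (s, r) * u i r))"
        by (simp add: sum_distrib_left mult_ac)
      also have "\<dots> = es ! i * (\<Sum>s<n. d s * u i s * v s)"
        using eig[OF i] by (simp add: sum_distrib_left mult_ac)
      finally have "(\<Sum>r<n. d r * u i r * (\<Sum>s<n. A $$ (r, s) * v s)) = 0"
        using vu[OF i] by simp
      moreover have "(\<Sum>r<n. d r * u i r * (\<Sum>s<n. A $$ (r, s) * v s))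
          = (\<Sum>r<n. es ! m * (d r * u i r * v r) + (\<Sum>j<m. b j * (d r * u i r * u j r)))"
        by (intro sum.cong refl, simp only: Av lessThan_iff)
          (simp add: algebra_simps sum_distrib_left)
      moreover have "\<dots> = es ! m * (\<Sum>r<n. d r * u i r * v r)
          + (\<Sum>j<m. b j * (\<Sum>r<n. d r * u i r * u j r))"
        unfolding sum.distrib sum_distrib_left by (simp add: sum.swap[of _ "{..<m}"])
      moreover have "(\<Sum>j<m. b j * (\<Sum>r<n. d r * u i r * u j r)) = (\<Sum>j<m. if j = i then b i else 0)"
        using i orth by (intro sum.cong) auto
      ultimately show ?thesis using vu[OF i] i by simp
    qed
    \<comment> \<open>The rows of \<open>Q\<close> are dual to the columns of \<open>P\<close>. The
      value 1 at \<open>i = m\<close> makes \<open>v\<close> nonzero; the zeros beyond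
      \<open>m\<close> carry the third conjunct to the next stage.\<close>
    have Qv: "(\<Sum>r<n. Q $$ (i, r) * v r) = (if i = m then 1 else 0)" if "m \<le> i" "i < n" for i
    proof -
      have "(\<Sum>r<n. Q $$ (i, r) * v r) = (\<Sum>r<n. Q $$ (i, r) * P $$ (r, m))
          - (\<Sum>r<n. \<Sum>j<m. t j * (Q $$ (i, r) * u j r))"
        unfolding v_def by (simp add: algebra_simps sum_subtractf sum_distrib_left)
      also have "(\<Sum>r<n. \<Sum>j<m. t j * (Q $$ (i, r) * u j r)) = 0"
        by (subst sum.swap) (simp add: Qu that flip: sum_distrib_left)
      finally show ?thesis using QP' that m by simp
    qed
    define N where "N = (\<Sum>r<n. d r * v r * v r)"
    have "N > 0"
    proof -
      have "\<exists>r<n. v r \<noteq> 0" using Qv[of m] m by (auto intro: ccontr)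
      then obtain r where r: "r < n" "v r \<noteq> 0" by blast
      have "0 < d r * v r * v r"
        using r pos[of r] by (auto simp: mult.assoc zero_less_mult_iff)
      also have "\<dots> \<le> N"
        unfolding N_def using r pos[THEN less_imp_le]
        by (intro member_le_sum) (auto simp: mult.assoc)
      finally show ?thesis .
    qed
    define z where "z = sqrt N"
    have z: "z > 0" "z * z = N" using \<open>N > 0\<close> by (auto simp: z_def)
    define u' where "u' j = (if j = m then (\<lambda>r. v r / z) else u j)" for j
    have u'_lt: "u' j = u j" if "j < m" for j using that by (simp add: u'_def)
    have u'_m: "u' m = (\<lambda>r. v r / z)" by (simp add: u'_def)
    have "(\<Sum>r<n. d r * u' i r * u' j r) = (if i = j then 1 else 0)" if ij: "i < Suc m" "j < Suc m" for i j
    proof -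
      consider "i < m" "j < m" | "i = m" "j < m" | "i < m" "j = m" | "i = m" "j = m"
        using ij by linarith
      then show ?thesis
      proof cases
        case 1
        then show ?thesis using orth by (simp add: u'_lt)
      next
        case 2
        have "(\<Sum>r<n. d r * u' i r * u' j r) = (\<Sum>r<n. d r * u j r * v r) / z"
          using 2 by (simp add: u'_lt u'_m sum_divide_distrib mult_ac)
        then show ?thesis using vu 2 by simp
      next
        case 3
        have "(\<Sum>r<n. d r * u' i r * u' j r) = (\<Sum>r<n. d r * u i r * v r) / z"
          using 3 by (simp add: u'_lt u'_m sum_divide_distrib mult_ac)
        then show ?thesis using vu 3 by simp
      next
        case 4
        have "(\<Sum>r<n. d r * u' i r * u' j r) = N / (z * z)"
          using 4 by (simp add: u'_m N_def sum_divide_distrib)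
        then show ?thesis using 4 z \<open>N > 0\<close> by simp
      qed
    qed
    moreover have "(\<Sum>s<n. A $$ (r, s) * u' j s) = es ! j * u' j r" if "j < Suc m" "r < n" for j r
    proof (cases "j = m")
      case True
      have "(\<Sum>s<n. A $$ (r, s) * u' j s) = (\<Sum>s<n. A $$ (r, s) * v s) / z"
        by (simp add: True u'_m sum_divide_distrib)
      then show ?thesis using Av[OF that(2)] b0 by (simp add: True u'_m)
    qed (use that eig u'_lt in auto)
    moreover have "(\<Sum>r<n. Q $$ (i, r) * u' j r) = 0" if "j < Suc m" "Suc m \<le> i" "i < n" for i j
    proof (cases "j = m")
      case True
      have "(\<Sum>r<n. Q $$ (i, r) * u' j r) = (\<Sum>r<n. Q $$ (i, r) * v r) / z"
        by (simp add: True u'_m sum_divide_distrib)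
      then show ?thesis using Qv[of i] that by simp
    qed (use that Qu u'_lt in auto)
    moreover have "\<exists>a. \<forall>r<n. P $$ (r, c) = (\<Sum>j<Suc m. a j * u' j r)" if "c < Suc m" for c
    proof (cases "c = m")
      case True
      \<comment> \<open>Column \<open>m\<close> of \<open>P\<close> is \<open>v\<close> plus the
        combination with coefficients \<open>t\<close>, and \<open>v\<close> is \<open>z\<close>
        times the new vector.\<close>
      show ?thesis
        using z by (intro exI[of _ "t(m := z)"]) (simp add: True u'_m u'_lt v_def)
    next
      case False
      then show ?thesis
        using a[of c] that by (intro exI[of _ "(a c)(m := 0)"]) (simp add: u'_lt)
    qed
    ultimately show ?case by (intro exI[of _ u']) auto
  qed
  from this[of n] show ?thesis by blast
qed


section \<open>Kernels on a finite set and their spectral bases\<close>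

text \<open>Separates the entries, a function of two elements, from the enumeration
  \<open>xs\<close>; for distinct \<open>xs\<close>, sums over positions become sums over
  \<open>set xs\<close>.\<close>

definition kernel_mat :: "'b list \<Rightarrow> ('b \<Rightarrow> 'b \<Rightarrow> real) \<Rightarrow> real mat" where
  "kernel_mat xs g = mat (length xs) (length xs) (\<lambda>(i, j). g (xs ! i) (xs ! j))"

lemma sum_nth_distinct:
  assumes "distinct xs"
  shows "(\<Sum>i<length xs. F (xs ! i)) = (\<Sum>x\<in>set xs. F x)"
  using sum.reindex_bij_betw[OF bij_betw_nth[OF assms refl refl], of F] by simp

text \<open>Tagging every index with its block keeps indices distinct even when one face lies in
  several links.\<close>

lemma diag_block_kernel_mat:
  assumes "distinct es"
  shows "diag_block_mat (map (\<lambda>e. kernel_mat (ys e) (h e)) es) =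
    kernel_mat (concat (map (\<lambda>e. map (Pair e) (ys e)) es))
      (\<lambda>(a, s) (b, t). if a = b then h a s t else 0)"
  using assms
proof (induction es)
  case Nil
  show ?case by (auto simp: kernel_mat_def)
next
  case (Cons e es)
  let ?zs = "concat (map (\<lambda>e. map (Pair e) (ys e)) es)"
  let ?g = "\<lambda>(a, s) (b, t). if a = b then h a s t else 0"
  \<comment> \<open>No later block carries the tag \<open>e\<close>, so the entries outside the
    diagonal blocks vanish.\<close>
  have ne: "fst (?zs ! i) \<noteq> e" if "i < length ?zs" for i
    using nth_mem[OF that] Cons.prems by auto
  have eq: "diag_block_mat (map (\<lambda>e. kernel_mat (ys e) (h e)) es) = kernel_mat ?zs ?g"
    using Cons by simp
  show ?case
    unfolding list.map diag_block_mat.simps eq Let_def concat.simps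
    using ne ne[symmetric]
    by (intro eq_matI) (auto simp: kernel_mat_def nth_append case_prod_beta not_less)
qed

text \<open>Packages what a min-max argument needs: orthonormality, the eigenvalue equation, the
  expansion of any function, and monotone eigenvalues. Basis vectors are counted from 0 and
  \<open>nth_eigenvalue\<close> from 1, hence \<open>Suc j\<close>.\<close>

lemma kernel_spectral_basis:
  fixes g :: "'b \<Rightarrow> 'b \<Rightarrow> real"
  assumes dist: "distinct xs"
    and pos: "\<And>x. x \<in> set xs \<Longrightarrow> d x > 0"
    and sym: "\<And>x y. x \<in> set xs \<Longrightarrow> y \<in> set xs \<Longrightarrow> d x * g x y = d y * g y x"
  obtains p where
    "\<forall>i<length xs. \<forall>j<length xs.
       (\<Sum>x\<in>set xs. d x * p i x * p j x) = (if i = j then 1 else 0)"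
    "\<forall>j<length xs. \<forall>x\<in>set xs.
       (\<Sum>y\<in>set xs. g x y * p j y) = nth_eigenvalue (kernel_mat xs g) (Suc j) * p j x"
    "\<forall>f. \<forall>x\<in>set xs.
       f x = (\<Sum>j<length xs. (\<Sum>y\<in>set xs. d y * p j y * f y) * p j x)"
    "\<forall>j<length xs. \<forall>i\<le>j.
       nth_eigenvalue (kernel_mat xs g) (Suc i) \<le> nth_eigenvalue (kernel_mat xs g) (Suc j)"
proof -
  define n where "n = length xs"
  define A where "A = kernel_mat xs g"
  have A: "A \<in> carrier_mat n n" by (simp add: A_def kernel_mat_def n_def)
  have A_ix: "A $$ (r, s) = g (xs ! r) (xs ! s)" if "r < n" "s < n" for r s
    using that by (simp add: A_def kernel_mat_def n_def)
  have pos': "d (xs ! r) > 0" if "r < n" for r using pos that by (simp add: n_def)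
  have sym': "d (xs ! r) * A $$ (r, s) = d (xs ! s) * A $$ (s, r)" if "r < n" "s < n" for r s
    using that sym by (simp add: A_ix n_def)
  obtain es where es: "sorted es" "length es = n" and char: "char_poly A = (\<Prod>e\<leftarrow>es. [:- e, 1:])"
    using char_poly_splits_real[of A n "\<lambda>r. d (xs ! r)", OF A pos' sym'] by blast
  have nth: "nth_eigenvalue A (Suc j) = es ! j" for j
    using nth_eigenvalue_eq_nth[OF es(1) char] by simp
  obtain u where
    orth: "\<And>i j. i < n \<Longrightarrow> j < n \<Longrightarrow> (\<Sum>r<n. d (xs ! r) * u i r * u j r) = (if i = j then 1 else 0)"
    and eig: "\<And>j r. j < n \<Longrightarrow> r < n \<Longrightarrow> (\<Sum>s<n. A $$ (r, s) * u j s) = es ! j * u j r"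
    using orthonormal_eigenvectors[of A n "\<lambda>r. d (xs ! r)" es, OF A pos' sym' char] by blast
  define U where "U = mat n n (\<lambda>(r, j). u j r)"
  define U' where "U' = mat n n (\<lambda>(j, r). d (xs ! r) * u j r)"
  have U: "U \<in> carrier_mat n n" "U' \<in> carrier_mat n n" by (auto simp: U_def U'_def)
  have "U' * U = 1\<^sub>m n"
    by (rule eq_matI) (auto simp: U_def U'_def scalar_prod_def orth simp flip: lessThan_atLeast0)
  \<comment> \<open>Orthonormality makes \<open>U'\<close> a left inverse of \<open>U\<close>. For
    square matrices it is also a right inverse, which is completeness of the basis.\<close>
  then have UU': "U * U' = 1\<^sub>m n"
    using mat_mult_left_right_inverse U by blast
  have compl: "(\<Sum>j<n. u j r * (d (xs ! s) * u j s)) = (if r = s then 1 else 0)" if "r < n" "s < n" for r s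
    using arg_cong[OF UU', of "\<lambda>M. M $$ (r, s)"] that
    by (simp add: U_def U'_def scalar_prod_def lessThan_atLeast0)
  define ix where "ix x = (THE r. r < n \<and> xs ! r = x)" for x
  have ix: "ix (xs ! r) = r" if "r < n" for r
    unfolding ix_def using that dist by (auto simp: n_def nth_eq_iff_index_eq intro!: the_equality)
  define p where "p j x = u j (ix x)" for j x
  have p: "p j (xs ! r) = u j r" if "r < n" for j r using ix that by (simp add: p_def)
  have sums: "(\<Sum>x\<in>set xs. F x) = (\<Sum>r<n. F (xs ! r))" for F :: "'b \<Rightarrow> real"
    using sum_nth_distinct[OF dist, of F] by (simp add: n_def)
  show ?thesis
  proof (rule that[of p], unfold sums n_def[symmetric] A_def[symmetric] nth, safe)
    show "(\<Sum>r<n. d (xs ! r) * p i (xs ! r) * p j (xs ! r)) = (if i = j then 1 else 0)"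
      if "i < n" "j < n" for i j
      using orth[OF that] p by simp
    show "(\<Sum>s<n. g x (xs ! s) * p j (xs ! s)) = es ! j * p j x" if "j < n" "x \<in> set xs" for j x
    proof -
      obtain r where r: "r < n" "x = xs ! r" using \<open>x \<in> set xs\<close> by (metis in_set_conv_nth n_def)
      show ?thesis using eig[OF that(1) r(1)] by (simp add: r p A_ix)
    qed
    show "f x = (\<Sum>j<n. (\<Sum>s<n. d (xs ! s) * p j (xs ! s) * f (xs ! s)) * p j x)"
      if "x \<in> set xs" for f x
    proof -
      obtain r where r: "r < n" "x = xs ! r" using \<open>x \<in> set xs\<close> by (metis in_set_conv_nth n_def)
      have "(\<Sum>j<n. (\<Sum>s<n. d (xs ! s) * p j (xs ! s) * f (xs ! s)) * p j x)
          = (\<Sum>s<n. f (xs ! s) * (\<Sum>j<n. u j r * (d (xs ! s) * u j s)))"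
        unfolding sum_distrib_left sum_distrib_right
        by (subst sum.swap) (simp add: r p mult_ac)
      also have "\<dots> = (\<Sum>s<n. if s = r then f (xs ! r) else 0)"
        using r by (intro sum.cong refl) (auto simp: compl)
      finally show ?thesis using r by simp
    qed
    show "es ! i \<le> es ! j" if "j < n" "i \<le> j" for i j
      using that es by (simp add: sorted_nth_mono)
  qed
qed

section \<open>Comparison of eigenvalues along a linear map\<close>

text \<open>There are \<open>m\<close> equations in \<open>m + 1\<close> unknowns; padding with a
  zero row gives a square matrix of determinant 0.\<close>

lemma exists_nontrivial_solution:
  fixes a :: "nat \<Rightarrow> nat \<Rightarrow> real"
  obtains v where "\<And>r. r < m \<Longrightarrow> (\<Sum>c<Suc m. a r c * v c) = 0" "\<exists>c<Suc m. v c \<noteq> 0"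
proof -
  define M where "M = mat (Suc m) (Suc m) (\<lambda>(r, c). if r < m then a r c else 0)"
  have M: "M \<in> carrier_mat (Suc m) (Suc m)" by (simp add: M_def)
  have "M = mat\<^sub>r (Suc m) (Suc m) (\<lambda>r. if r = m then 0\<^sub>v (Suc m) else row M r)"
    by (intro eq_matI) (auto simp: M_def)
  then have "det M = 0" using det_row_0[of m "Suc m" "row M"] M by auto
  then obtain x where x: "x \<in> carrier_vec (Suc m)" "x \<noteq> 0\<^sub>v (Suc m)" "M *\<^sub>v x = 0\<^sub>v (Suc m)"
    using det_0_iff_vec_prod_zero[OF M] by blast
  show ?thesis
  proof (rule that[of "\<lambda>c. x $ c"])
    show "(\<Sum>c<Suc m. a r c * x $ c) = 0" if "r < m" for r
      using arg_cong[OF x(3), of "\<lambda>y. y $ r"] that x(1)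
      by (simp add: M_def scalar_prod_def lessThan_atLeast0)
    show "\<exists>c<Suc m. x $ c \<noteq> 0"
      using x(1,2) by (metis carrier_vecD eq_vecI index_zero_vec)
  qed
qed

text \<open>Parseval in polarized form, so that it covers both the norm of a function and its
  pairing with its image under the operator.\<close>

lemma orthonormal_inner_product:
  fixes p :: "nat \<Rightarrow> 'b \<Rightarrow> real"
  assumes "\<And>i j. i < n \<Longrightarrow> j < n \<Longrightarrow> (\<Sum>x\<in>S. d x * p i x * p j x) = (if i = j then 1 else 0)"
    and "\<And>x. x \<in> S \<Longrightarrow> f x = (\<Sum>j<n. v j * p j x)"
    and "\<And>x. x \<in> S \<Longrightarrow> f' x = (\<Sum>j<n. v' j * p j x)"
  shows "(\<Sum>x\<in>S. d x * f x * f' x) = (\<Sum>j<n. v j * v' j)"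
proof -
  have "(\<Sum>x\<in>S. d x * f x * f' x)
      = (\<Sum>x\<in>S. \<Sum>i<n. \<Sum>j<n. v i * v' j * (d x * p i x * p j x))"
    by (intro sum.cong refl) (simp add: assms sum_product sum_distrib_left mult_ac)
  also have "\<dots> = (\<Sum>i<n. \<Sum>j<n. v i * v' j * (\<Sum>x\<in>S. d x * p i x * p j x))"
    by (simp add: sum.swap[of _ _ S] sum_distrib_left)
  also have "\<dots> = (\<Sum>i<n. \<Sum>j<n. if j = i then v i * v' i else 0)"
    using assms(1) by (intro sum.cong refl) auto
  finally show ?thesis by simp
qed

lemma kernel_linear_combination:
  fixes g :: "'b \<Rightarrow> 'b \<Rightarrow> real"
  assumes "\<And>j. j < n \<Longrightarrow> (\<Sum>y\<in>S. g x y * p j y) = l j * p j x"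
    and "\<And>y. y \<in> S \<Longrightarrow> f y = (\<Sum>j<n. v j * p j y)"
  shows "(\<Sum>y\<in>S. g x y * f y) = (\<Sum>j<n. (l j * v j) * p j x)"
proof -
  have "(\<Sum>y\<in>S. g x y * f y) = (\<Sum>y\<in>S. \<Sum>j<n. v j * (g x y * p j y))"
    by (intro sum.cong refl) (simp add: assms(2) sum_distrib_left mult_ac)
  also have "\<dots> = (\<Sum>j<n. v j * (\<Sum>y\<in>S. g x y * p j y))"
    by (subst sum.swap) (simp add: sum_distrib_left)
  finally show ?thesis by (simp add: assms(1) mult_ac)
qed

text \<open>The Courant--Fischer argument: among the combinations of the first \<open>i\<close> eigenvectors of the
  first operator, choose one whose image under \<open>T\<close> is orthogonal to the first \<open>i - 1\<close>
  eigenvectors of the second.\<close>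

lemma nth_eigenvalue_comparison:
  fixes g :: "'b \<Rightarrow> 'b \<Rightarrow> real" and h :: "'c \<Rightarrow> 'c \<Rightarrow> real"
    and T :: "('b \<Rightarrow> real) \<Rightarrow> 'c \<Rightarrow> real"
  assumes xs: "distinct xs" "\<And>x. x \<in> set xs \<Longrightarrow> d x > 0"
      "\<And>x y. x \<in> set xs \<Longrightarrow> y \<in> set xs \<Longrightarrow> d x * g x y = d y * g y x"
    and ys: "distinct ys" "\<And>x. x \<in> set ys \<Longrightarrow> e x > 0"
      "\<And>x y. x \<in> set ys \<Longrightarrow> y \<in> set ys \<Longrightarrow> e x * h x y = e y * h y x"
    and T_linear: "\<And>(m::nat) v q y. y \<in> set ys \<Longrightarrow>
      T (\<lambda>x. \<Sum>c<m. v c * q c x) y = (\<Sum>c<m. v c * T (q c) y)"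
    and T_norm: "\<And>f. (\<Sum>y\<in>set ys. e y * (T f y)\<^sup>2) = C * (\<Sum>x\<in>set xs. d x * (f x)\<^sup>2)"
    and T_form: "\<And>f. (\<Sum>y\<in>set ys. e y * T f y * (\<Sum>z\<in>set ys. h y z * T f z))
      \<le> a * (\<Sum>x\<in>set xs. d x * f x * (\<Sum>y\<in>set xs. g x y * f y)) + b * (\<Sum>x\<in>set xs. d x * (f x)\<^sup>2)"
    and a: "a \<ge> 0"
    and i: "1 \<le> i" "i \<le> length xs" "i \<le> length ys"
  shows "C * nth_eigenvalue (kernel_mat ys h) i \<le> a * nth_eigenvalue (kernel_mat xs g) i + b"
proof -
  obtain m where m: "i = Suc m" using i(1) by (cases i) auto
  obtain p where
    p_orth: "\<forall>i<length xs. \<forall>j<length xs.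
       (\<Sum>x\<in>set xs. d x * p i x * p j x) = (if i = j then 1 else 0)"
    and p_eig: "\<forall>j<length xs. \<forall>x\<in>set xs.
       (\<Sum>y\<in>set xs. g x y * p j y) = nth_eigenvalue (kernel_mat xs g) (Suc j) * p j x"
    and "\<forall>f. \<forall>x\<in>set xs.
       f x = (\<Sum>j<length xs. (\<Sum>y\<in>set xs. d y * p j y * f y) * p j x)"
    and p_mono: "\<forall>j<length xs. \<forall>i\<le>j.
       nth_eigenvalue (kernel_mat xs g) (Suc i) \<le> nth_eigenvalue (kernel_mat xs g) (Suc j)"
    by (rule kernel_spectral_basis[of xs d g, OF xs])
  obtain q where
    q_orth: "\<forall>i<length ys. \<forall>j<length ys.
       (\<Sum>x\<in>set ys. e x * q i x * q j x) = (if i = j then 1 else 0)"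
    and q_eig: "\<forall>j<length ys. \<forall>x\<in>set ys.
       (\<Sum>y\<in>set ys. h x y * q j y) = nth_eigenvalue (kernel_mat ys h) (Suc j) * q j x"
    and q_exp: "\<forall>f. \<forall>x\<in>set ys.
       f x = (\<Sum>j<length ys. (\<Sum>y\<in>set ys. e y * q j y * f y) * q j x)"
    and q_mono: "\<forall>j<length ys. \<forall>i\<le>j.
       nth_eigenvalue (kernel_mat ys h) (Suc i) \<le> nth_eigenvalue (kernel_mat ys h) (Suc j)"
    by (rule kernel_spectral_basis[of ys e h, OF ys])
  let ?l = "\<lambda>j. nth_eigenvalue (kernel_mat xs g) (Suc j)"
  let ?m = "\<lambda>j. nth_eigenvalue (kernel_mat ys h) (Suc j)"
  obtain v where v: "\<And>r. r < m \<Longrightarrow> (\<Sum>c<Suc m. (\<Sum>y\<in>set ys. e y * q r y * T (p c) y) * v c) = 0"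
    and v0: "\<exists>c<Suc m. v c \<noteq> 0"
    using exists_nontrivial_solution[of m "\<lambda>r c. \<Sum>y\<in>set ys. e y * q r y * T (p c) y"] by blast
  define f where "f x = (\<Sum>c<Suc m. v c * p c x)" for x
  have le: "Suc m \<le> length xs" using i m by simp
  have norm_f: "(\<Sum>x\<in>set xs. d x * (f x)\<^sup>2) = (\<Sum>c<Suc m. (v c)\<^sup>2)"
    unfolding power2_eq_square mult.assoc[symmetric]
    by (rule orthonormal_inner_product[where p = p]) (use p_orth le in \<open>auto simp: f_def\<close>)
  have gf: "(\<Sum>y\<in>set xs. g x y * f y) = (\<Sum>c<Suc m. (?l c * v c) * p c x)" if "x \<in> set xs" for x
    by (rule kernel_linear_combination) (use p_eig le that in \<open>auto simp: f_def\<close>)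
  have form_f: "(\<Sum>x\<in>set xs. d x * f x * (\<Sum>y\<in>set xs. g x y * f y)) = (\<Sum>c<Suc m. ?l c * (v c)\<^sup>2)"
    by (subst orthonormal_inner_product[where p = p and n = "Suc m", OF _ f_def gf])
      (use p_orth le in \<open>auto simp: power2_eq_square mult_ac simp del: sum.lessThan_Suc\<close>)
  define w where "w j = (\<Sum>y\<in>set ys. e y * q j y * T f y)" for j
  have Tf: "T f y = (\<Sum>j<length ys. w j * q j y)" if "y \<in> set ys" for y
    using q_exp that unfolding w_def by blast
  have w0: "w j = 0" if "j < m" for j
  proof -
    have "w j = (\<Sum>y\<in>set ys. \<Sum>c<Suc m. e y * q j y * T (p c) y * v c)"
      unfolding w_def f_def by (intro sum.cong refl) (simp only: T_linear sum_distrib_left mult_ac)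
    also have "\<dots> = 0"
      using v[OF that] by (subst sum.swap) (simp only: sum_distrib_right)
    finally show ?thesis .
  qed
  have norm_Tf: "(\<Sum>y\<in>set ys. e y * (T f y)\<^sup>2) = (\<Sum>j<length ys. (w j)\<^sup>2)"
    unfolding power2_eq_square mult.assoc[symmetric]
    by (rule orthonormal_inner_product[where p = q]) (use q_orth Tf in auto)
  have hTf: "(\<Sum>z\<in>set ys. h y z * T f z) = (\<Sum>j<length ys. (?m j * w j) * q j y)"
    if "y \<in> set ys" for y
    by (rule kernel_linear_combination) (use q_eig Tf that in auto)
  have form_Tf: "(\<Sum>y\<in>set ys. e y * T f y * (\<Sum>z\<in>set ys. h y z * T f z)) = (\<Sum>j<length ys. ?m j * (w j)\<^sup>2)"
    by (subst orthonormal_inner_product[where p = q and n = "length ys", OF _ Tf hTf])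
      (use q_orth in \<open>auto simp: power2_eq_square mult_ac\<close>)
  define N where "N = (\<Sum>x\<in>set xs. d x * (f x)\<^sup>2)"
  obtain c where "c < Suc m" "v c \<noteq> 0" using v0 by blast
  then have "N > 0"
    unfolding N_def norm_f by (intro sum_pos2[of _ c]) auto
  \<comment> \<open>\<open>T f\<close> has no component below index \<open>m\<close>, which bounds
    its form from below by \<open>?m m\<close> times its norm; \<open>f\<close> has none above
    \<open>m\<close>, which bounds its own form from above by \<open>?l m\<close> times its norm.
    The sign of \<open>a\<close> matters for the second bound.\<close>
  have "C * ?m m * N = (\<Sum>j<length ys. ?m m * (w j)\<^sup>2)"
    using T_norm[of f] norm_Tf by (simp add: N_def mult_ac flip: sum_distrib_left)
  also have "\<dots> \<le> (\<Sum>j<length ys. ?m j * (w j)\<^sup>2)"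
  proof (rule sum_mono)
    show "?m m * (w j)\<^sup>2 \<le> ?m j * (w j)\<^sup>2" if "j \<in> {..<length ys}" for j
      using that w0[of j] q_mono by (cases "j < m") (auto intro: mult_right_mono)
  qed
  also have "\<dots> \<le> a * (\<Sum>c<Suc m. ?l c * (v c)\<^sup>2) + b * N"
    using T_form[of f] unfolding form_Tf form_f N_def .
  also have "\<dots> \<le> a * (\<Sum>c<Suc m. ?l m * (v c)\<^sup>2) + b * N"
    using p_mono i m a
    by (intro add_right_mono mult_left_mono sum_mono mult_right_mono) auto
  also have "\<dots> = (a * ?l m + b) * N"
    unfolding N_def norm_f sum_distrib_left[symmetric] by (simp only: algebra_simps)
  finally show ?thesis using \<open>N > 0\<close> m by simp
qed

section \<open>Laplacians as kernels\<close>

text \<open>The entry of the boundary matrix as a function of faces instead of positions. The sign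
  is meaningful when \<sigma> lacks exactly one vertex of \<tau>, as for nested faces of consecutive
  dimensions.\<close>

definition incidence :: "'a::linorder set \<Rightarrow> 'a set \<Rightarrow> real" where
  "incidence \<tau> \<sigma> = (if \<sigma> \<subset> \<tau> then incidence_sign \<tau> \<sigma> else 0)"

text \<open>The two matrix products written out entrywise. The case distinction at the top dimension
  disappears: there the sum over \<open>faces X (k + 1)\<close> is empty.\<close>

definition laplacian_kernel ::
  "'a::linorder set set \<Rightarrow> ('a set \<Rightarrow> real) \<Rightarrow> int \<Rightarrow> 'a set \<Rightarrow> 'a set \<Rightarrow> real" where
  "laplacian_kernel X w k \<sigma> \<sigma>' =
     inverse (w \<sigma>) * (\<Sum>\<tau>\<in>faces X (k + 1). incidence \<tau> \<sigma> * w \<tau> * incidence \<tau> \<sigma>')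
     + (\<Sum>\<rho>\<in>faces X (k - 1). incidence \<sigma> \<rho> * inverse (w \<rho>) * incidence \<sigma>' \<rho>) * w \<sigma>'"

lemma simplicial_complex_finite:
  assumes "simplicial_complex V X"
  shows "finite V" "finite X" "\<sigma> \<in> X \<Longrightarrow> finite \<sigma>" "finite (faces X k)"
proof -
  show "finite V" and fin: "finite X"
    using assms by (auto simp: simplicial_complex_def intro: finite_subset[of X "Pow V"])
  show "\<sigma> \<in> X \<Longrightarrow> finite \<sigma>"
    using assms by (auto simp: simplicial_complex_def intro: finite_subset[of _ V])
  show "finite (faces X k)" using fin by (simp add: faces_def)
qed

lemma simplicial_complex_subset:
  assumes "simplicial_complex V X" "\<tau> \<in> X" "\<sigma> \<subseteq> \<tau>"
  shows "\<sigma> \<in> X"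
  using assms unfolding simplicial_complex_def by blast

text \<open>Reconciles two conventions with plain sums over faces: the zero upper Laplacian in top
  dimension, and the omission of links of too small a dimension.\<close>

lemma faces_empty_above_dim:
  assumes "finite X" "complex_dim X < k"
  shows "faces X k = {}"
proof -
  have "card \<sigma> \<le> Max (card ` X)" if "\<sigma> \<in> X" for \<sigma>
    using assms(1) that by simp
  then show ?thesis
    using assms(2) by (fastforce simp: faces_def complex_dim_def)
qed

lemma sum_enum_list:
  assumes "finite S"
  shows "(\<Sum>i<card S. F (enum_list S ! i)) = (\<Sum>x\<in>S. F x)"
  using sum_nth_distinct[OF enum_list(1)[OF assms], of F] enum_list[OF assms] by simp

lemma boundary_mat_carrier: "boundary_mat X k \<in> carrier_mat (card (faces X (k - 1))) (card (faces X k))"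
  by (simp add: boundary_mat_def)

lemma boundary_mat_index:
  assumes "i < card (faces X (k - 1))" "j < card (faces X k)"
  shows "boundary_mat X k $$ (i, j) = incidence (enum_list (faces X k) ! j) (enum_list (faces X (k - 1)) ! i)"
  using assms by (simp add: boundary_mat_def incidence_def Let_def)

lemma upper_laplacian_index:
  assumes "finite X" "i < card (faces X k)" "j < card (faces X k)"
  defines "\<sigma> \<equiv> enum_list (faces X k) ! i" and "\<sigma>' \<equiv> enum_list (faces X k) ! j"
  shows "upper_laplacian X w k $$ (i, j)
    = inverse (w \<sigma>) * (\<Sum>\<tau>\<in>faces X (k + 1). incidence \<tau> \<sigma> * w \<tau> * incidence \<tau> \<sigma>')"
proof (cases "k < complex_dim X")
  case False
  then have "faces X (k + 1) = {}" using assms(1) by (intro faces_empty_above_dim) auto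
  with False assms show ?thesis by (simp add: upper_laplacian_def)
next
  case True
  let ?n = "card (faces X k)" and ?m = "card (faces X (k + 1))"
  let ?B = "boundary_mat X (k + 1)"
  have B: "?B \<in> carrier_mat ?n ?m" using boundary_mat_carrier[of X "k + 1"] by simp
  have fin: "finite (faces X (k + 1))" using assms(1) by (simp add: faces_def)
  have "weight_mat_inv X w k * ?B * weight_mat X w (k + 1)
      = mat ?n ?m (\<lambda>(i, c). inverse (w (enum_list (faces X k) ! i)) * ?B $$ (i, c) * w (enum_list (faces X (k + 1)) ! c))"
    unfolding weight_mat_inv_def weight_mat_def mat_diag_mult_left[OF B]
    by (subst mat_diag_mult_right[of _ ?n]) auto
  then have "upper_laplacian X w k $$ (i, j)
     = (\<Sum>c<?m. inverse (w \<sigma>) * ?B $$ (i, c) * w (enum_list (faces X (k + 1)) ! c) * ?B $$ (j, c))"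
    using True B assms by (simp add: upper_laplacian_def scalar_prod_def lessThan_atLeast0)
  also have "\<dots> = (\<Sum>c<?m. (\<lambda>\<tau>. inverse (w \<sigma>) * (incidence \<tau> \<sigma> * w \<tau> * incidence \<tau> \<sigma>')) (enum_list (faces X (k + 1)) ! c))"
    using assms boundary_mat_index[of _ X "k + 1"] by (intro sum.cong) (auto simp: mult_ac)
  also have "\<dots> = (\<Sum>\<tau>\<in>faces X (k + 1). inverse (w \<sigma>) * (incidence \<tau> \<sigma> * w \<tau> * incidence \<tau> \<sigma>'))"
    by (rule sum_enum_list[OF fin])
  finally show ?thesis by (simp add: sum_distrib_left)
qed

lemma lower_laplacian_index:
  assumes "finite X" "i < card (faces X k)" "j < card (faces X k)"
  defines "\<sigma> \<equiv> enum_list (faces X k) ! i" and "\<sigma>' \<equiv> enum_list (faces X k) ! j"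
  shows "lower_laplacian X w k $$ (i, j)
    = (\<Sum>\<rho>\<in>faces X (k - 1). incidence \<sigma> \<rho> * inverse (w \<rho>) * incidence \<sigma>' \<rho>) * w \<sigma>'"
proof -
  let ?n = "card (faces X k)" and ?m = "card (faces X (k - 1))"
  let ?B = "boundary_mat X k"
  note B = boundary_mat_carrier[of X k]
  have fin: "finite (faces X (k - 1))" using assms(1) by (simp add: faces_def)
  have "transpose_mat ?B * weight_mat_inv X w (k - 1)
      = mat ?n ?m (\<lambda>(i, c). ?B $$ (c, i) * inverse (w (enum_list (faces X (k - 1)) ! c)))"
    unfolding weight_mat_inv_def using B by (subst mat_diag_mult_right[of _ ?n]) auto
  then have "(transpose_mat ?B * weight_mat_inv X w (k - 1) * ?B) $$ (i, j')
     = (\<Sum>c<?m. ?B $$ (c, i) * inverse (w (enum_list (faces X (k - 1)) ! c)) * ?B $$ (c, j'))"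
    if "j' < ?n" for j'
    using B assms that by (simp add: scalar_prod_def lessThan_atLeast0)
  moreover have "lower_laplacian X w k = mat ?n ?n (\<lambda>(i, j).
      (transpose_mat ?B * weight_mat_inv X w (k - 1) * ?B) $$ (i, j) * w (enum_list (faces X k) ! j))"
    unfolding lower_laplacian_def weight_mat_def using B
    by (subst mat_diag_mult_right[of _ ?n]) (auto simp: weight_mat_inv_def)
  ultimately have "lower_laplacian X w k $$ (i, j)
     = (\<Sum>c<?m. ?B $$ (c, i) * inverse (w (enum_list (faces X (k - 1)) ! c)) * ?B $$ (c, j)) * w \<sigma>'"
    using assms by simp
  also have "(\<Sum>c<?m. ?B $$ (c, i) * inverse (w (enum_list (faces X (k - 1)) ! c)) * ?B $$ (c, j))
     = (\<Sum>c<?m. (\<lambda>\<rho>. incidence \<sigma> \<rho> * inverse (w \<rho>) * incidence \<sigma>' \<rho>) (enum_list (faces X (k - 1)) ! c))"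
    using assms boundary_mat_index[of _ X k] by (intro sum.cong) auto
  also have "\<dots> = (\<Sum>\<rho>\<in>faces X (k - 1). incidence \<sigma> \<rho> * inverse (w \<rho>) * incidence \<sigma>' \<rho>)"
    by (rule sum_enum_list[OF fin])
  finally show ?thesis .
qed

lemma laplacian_eq_kernel_mat:
  assumes "finite X"
  shows "laplacian X w k = kernel_mat (enum_list (faces X k)) (laplacian_kernel X w k)"
proof -
  have "finite (faces X k)" using assms by (simp add: faces_def)
  then have len: "length (enum_list (faces X k)) = card (faces X k)" by (rule enum_list)
  have low: "lower_laplacian X w k \<in> carrier_mat (card (faces X k)) (card (faces X k))"
    using boundary_mat_carrier[of X k]
    by (intro carrier_matI) (auto simp: lower_laplacian_def weight_mat_def mat_diag_def)
  show ?thesis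
    unfolding laplacian_def kernel_mat_def len laplacian_kernel_def
    using low upper_laplacian_index[OF assms] lower_laplacian_index[OF assms]
    by (intro eq_matI) auto
qed

text \<open>Multiplying by \<open>w \<sigma>\<close> cancels the inverse weight in the upper part
  and completes the lower part to a factor \<open>w \<sigma> * w \<sigma>'\<close>; both are then
  symmetric. So the weight function itself serves as \<open>d\<close> in the spectral
  results.\<close>

lemma laplacian_kernel_symmetric:
  assumes "w \<sigma> > 0" "w \<sigma>' > 0"
  shows "w \<sigma> * laplacian_kernel X w k \<sigma> \<sigma>' = w \<sigma>' * laplacian_kernel X w k \<sigma>' \<sigma>"
  using assms by (simp add: laplacian_kernel_def algebra_simps)

text \<open>The form is the squared weighted norm of the coboundary of \<open>f\<close> plus that of
  its image under the adjoint. The factor \<open>w \<sigma>\<close> next to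
  \<open>f \<sigma>\<close> in the second square comes from taking the adjoint for weighted inner
  products.\<close>

lemma laplacian_quadratic_form:
  assumes "\<forall>\<sigma>\<in>faces X k. w \<sigma> > 0"
  shows "(\<Sum>\<sigma>\<in>faces X k. w \<sigma> * f \<sigma> * (\<Sum>\<sigma>'\<in>faces X k. laplacian_kernel X w k \<sigma> \<sigma>' * f \<sigma>'))
    = (\<Sum>\<tau>\<in>faces X (k + 1). w \<tau> * (\<Sum>\<sigma>\<in>faces X k. incidence \<tau> \<sigma> * f \<sigma>)\<^sup>2)
    + (\<Sum>\<rho>\<in>faces X (k - 1). inverse (w \<rho>) * (\<Sum>\<sigma>\<in>faces X k. incidence \<sigma> \<rho> * (w \<sigma> * f \<sigma>))\<^sup>2)"
proof -
  let ?S = "faces X k" and ?U = "faces X (k + 1)" and ?D = "faces X (k - 1)"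
  have "(\<Sum>\<sigma>\<in>?S. w \<sigma> * f \<sigma> * (\<Sum>\<sigma>'\<in>?S. laplacian_kernel X w k \<sigma> \<sigma>' * f \<sigma>'))
     = (\<Sum>\<sigma>\<in>?S. \<Sum>\<sigma>'\<in>?S. (\<Sum>\<tau>\<in>?U. w \<tau> * ((incidence \<tau> \<sigma> * f \<sigma>) * (incidence \<tau> \<sigma>' * f \<sigma>')))
         + (\<Sum>\<rho>\<in>?D. inverse (w \<rho>) * ((incidence \<sigma> \<rho> * (w \<sigma> * f \<sigma>)) * (incidence \<sigma>' \<rho> * (w \<sigma>' * f \<sigma>')))))"
    unfolding sum_distrib_left
  proof (intro sum.cong refl)
    fix \<sigma> \<sigma>' assume "\<sigma> \<in> ?S"
    then have "w \<sigma> \<noteq> 0" using assms by fastforce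
    then have "w \<sigma> * f \<sigma> * (laplacian_kernel X w k \<sigma> \<sigma>' * f \<sigma>')
      = f \<sigma> * f \<sigma>' * (\<Sum>\<tau>\<in>?U. incidence \<tau> \<sigma> * w \<tau> * incidence \<tau> \<sigma>')
       + w \<sigma> * f \<sigma> * w \<sigma>' * f \<sigma>' * (\<Sum>\<rho>\<in>?D. incidence \<sigma> \<rho> * inverse (w \<rho>) * incidence \<sigma>' \<rho>)"
      by (simp add: laplacian_kernel_def field_simps)
    then show "w \<sigma> * f \<sigma> * (laplacian_kernel X w k \<sigma> \<sigma>' * f \<sigma>')
      = (\<Sum>\<tau>\<in>?U. w \<tau> * ((incidence \<tau> \<sigma> * f \<sigma>) * (incidence \<tau> \<sigma>' * f \<sigma>')))
         + (\<Sum>\<rho>\<in>?D. inverse (w \<rho>) * ((incidence \<sigma> \<rho> * (w \<sigma> * f \<sigma>)) * (incidence \<sigma>' \<rho> * (w \<sigma>' * f \<sigma>'))))"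
      by (simp add: sum_distrib_left mult_ac)
  qed
  also have "\<dots> = (\<Sum>\<tau>\<in>?U. \<Sum>\<sigma>\<in>?S. \<Sum>\<sigma>'\<in>?S. w \<tau> * ((incidence \<tau> \<sigma> * f \<sigma>) * (incidence \<tau> \<sigma>' * f \<sigma>')))
     + (\<Sum>\<rho>\<in>?D. \<Sum>\<sigma>\<in>?S. \<Sum>\<sigma>'\<in>?S. inverse (w \<rho>) * ((incidence \<sigma> \<rho> * (w \<sigma> * f \<sigma>)) * (incidence \<sigma>' \<rho> * (w \<sigma>' * f \<sigma>'))))"
    unfolding sum.distrib by (simp only: sum.swap[of _ ?S ?U] sum.swap[of _ ?S ?D])
  finally show ?thesis by (simp only: power2_eq_square sum_product) (simp only: sum_distrib_left)
qed

section \<open>Localization to links\<close>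

text \<open>Here \<open>u\<close> need not belong to \<tau>, so a vertex of a link has a sign
  relative to \<eta> as well.\<close>

definition vertex_sign :: "'a::linorder set \<Rightarrow> 'a \<Rightarrow> real" where
  "vertex_sign \<tau> u = (- 1) ^ card {v\<in>\<tau>. v < u}"

lemma vertex_sign_square [simp]: "vertex_sign \<tau> u * vertex_sign \<tau> u = 1"
  by (simp add: vertex_sign_def flip: power_add)

lemma vertex_sign_union:
  assumes "finite \<tau>" "finite \<eta>" "\<tau> \<inter> \<eta> = {}"
  shows "vertex_sign (\<tau> \<union> \<eta>) u = vertex_sign \<tau> u * vertex_sign \<eta> u"
proof -
  have "{v\<in>\<tau> \<union> \<eta>. v < u} = {v\<in>\<tau>. v < u} \<union> {v\<in>\<eta>. v < u}" by auto
  then have "card {v\<in>\<tau> \<union> \<eta>. v < u} = card {v\<in>\<tau>. v < u} + card {v\<in>\<eta>. v < u}"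
    using assms by (simp add: card_Un_disjoint disjoint_iff)
  then show ?thesis by (simp add: vertex_sign_def power_add)
qed

lemma incidence_insert:
  assumes "u \<notin> \<sigma>"
  shows "incidence (insert u \<sigma>) \<sigma> = vertex_sign (insert u \<sigma>) u"
proof -
  have "insert u \<sigma> - \<sigma> = {u}" using assms by auto
  then show ?thesis
    using assms by (auto simp: incidence_def incidence_sign_def vertex_sign_def)
qed

lemma codim1_subset_obtain:
  assumes "finite \<tau>" "\<sigma> \<subset> \<tau>" "card \<tau> = Suc (card \<sigma>)"
  obtains u where "u \<notin> \<sigma>" "\<tau> = insert u \<sigma>"
proof -
  obtain u where u: "u \<in> \<tau>" "u \<notin> \<sigma>" using assms(2) by blast
  have "card (insert u \<sigma>) = card \<tau>"
    using assms u by (simp add: finite_subset[of \<sigma> \<tau>])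
  then have "insert u \<sigma> = \<tau>"
    using assms u by (intro card_subset_eq) auto
  then show ?thesis using that u by blast
qed

lemma int_card_Diff_singleton:
  assumes "finite \<tau>" "u \<in> \<tau>"
  shows "int (card (\<tau> - {u})) = int (card \<tau>) - 1"
  using card.remove[OF assms] by simp

text \<open>Only the faces \<tau> - {u} have nonzero incidence with \<tau>. As a sum over vertices,
  the boundary shows what passing to a link does: it omits the vertices of \<eta>.\<close>

lemma sum_incidence_boundary:
  assumes X: "simplicial_complex V X" and \<tau>: "\<tau> \<in> faces X (k + 1)"
  shows "(\<Sum>\<sigma>\<in>faces X k. incidence \<tau> \<sigma> * F \<sigma>) = (\<Sum>u\<in>\<tau>. vertex_sign \<tau> u * F (\<tau> - {u}))"
proof -
  have t: "\<tau> \<in> X" "int (card \<tau>) = k + 2" "finite \<tau>"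
    using \<tau> X simplicial_complex_finite(3) by (auto simp: faces_def)
  have "(\<Sum>\<sigma>\<in>faces X k. incidence \<tau> \<sigma> * F \<sigma>) = (\<Sum>\<sigma>\<in>(\<lambda>u. \<tau> - {u}) ` \<tau>. incidence \<tau> \<sigma> * F \<sigma>)"
  proof (rule sum.mono_neutral_right)
    show "finite (faces X k)" using X simplicial_complex_finite by blast
    show "(\<lambda>u. \<tau> - {u}) ` \<tau> \<subseteq> faces X k"
      using t simplicial_complex_subset[OF X t(1)] by (auto simp: faces_def int_card_Diff_singleton simp del: card_Diff_insert card_Diff_singleton)
    show "\<forall>\<sigma>\<in>faces X k - (\<lambda>u. \<tau> - {u}) ` \<tau>. incidence \<tau> \<sigma> * F \<sigma> = 0"
    proof
      fix \<sigma> assume \<sigma>: "\<sigma> \<in> faces X k - (\<lambda>u. \<tau> - {u}) ` \<tau>"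
      have "\<not> \<sigma> \<subset> \<tau>"
      proof
        assume "\<sigma> \<subset> \<tau>"
        then obtain u where "u \<notin> \<sigma>" "\<tau> = insert u \<sigma>"
          using \<sigma> t by (elim codim1_subset_obtain[rotated]) (auto simp: faces_def)
        then show False using \<sigma> by auto
      qed
      then show "incidence \<tau> \<sigma> * F \<sigma> = 0" by (simp add: incidence_def)
    qed
  qed
  also have "\<dots> = (\<Sum>u\<in>\<tau>. incidence \<tau> (\<tau> - {u}) * F (\<tau> - {u}))"
    by (subst sum.reindex) (auto simp: inj_on_def)
  also have "\<dots> = (\<Sum>u\<in>\<tau>. vertex_sign \<tau> u * F (\<tau> - {u}))"
  proof (rule sum.cong[OF refl])
    fix u assume "u \<in> \<tau>"
    then show "incidence \<tau> (\<tau> - {u}) * F (\<tau> - {u}) = vertex_sign \<tau> u * F (\<tau> - {u})"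
      using incidence_insert[of u "\<tau> - {u}"] by (simp add: insert_absorb)
  qed
  finally show ?thesis .
qed

lemma sum_incidence_coboundary:
  assumes X: "simplicial_complex V X" and \<rho>: "\<rho> \<in> faces X (k - 1)"
  shows "(\<Sum>\<sigma>\<in>faces X k. incidence \<sigma> \<rho> * F \<sigma>)
    = (\<Sum>u\<in>neighbours V X \<rho>. vertex_sign (insert u \<rho>) u * F (insert u \<rho>))"
proof -
  have r: "\<rho> \<in> X" "int (card \<rho>) = k" "finite \<rho>"
    using \<rho> X simplicial_complex_finite(3) by (auto simp: faces_def)
  have "(\<Sum>\<sigma>\<in>faces X k. incidence \<sigma> \<rho> * F \<sigma>)
      = (\<Sum>\<sigma>\<in>(\<lambda>u. insert u \<rho>) ` neighbours V X \<rho>. incidence \<sigma> \<rho> * F \<sigma>)"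
  proof (rule sum.mono_neutral_right)
    show "finite (faces X k)" using X simplicial_complex_finite by blast
    show "(\<lambda>u. insert u \<rho>) ` neighbours V X \<rho> \<subseteq> faces X k"
      using r by (auto simp: faces_def neighbours_def)
    show "\<forall>\<sigma>\<in>faces X k - (\<lambda>u. insert u \<rho>) ` neighbours V X \<rho>. incidence \<sigma> \<rho> * F \<sigma> = 0"
    proof
      fix \<sigma> assume \<sigma>: "\<sigma> \<in> faces X k - (\<lambda>u. insert u \<rho>) ` neighbours V X \<rho>"
      then have s: "\<sigma> \<in> X" "finite \<sigma>" "int (card \<sigma>) = k + 1" "\<sigma> \<subseteq> V"
        using X simplicial_complex_finite(3)[OF X] by (auto simp: faces_def simplicial_complex_def)
      have "\<not> \<rho> \<subset> \<sigma>"
      proof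
        assume "\<rho> \<subset> \<sigma>"
        then obtain u where "u \<notin> \<rho>" "\<sigma> = insert u \<rho>"
          using s r by (elim codim1_subset_obtain[rotated]) auto
        then show False using \<sigma> s by (auto simp: neighbours_def)
      qed
      then show "incidence \<sigma> \<rho> * F \<sigma> = 0" by (simp add: incidence_def)
    qed
  qed
  also have "\<dots> = (\<Sum>u\<in>neighbours V X \<rho>. incidence (insert u \<rho>) \<rho> * F (insert u \<rho>))"
    by (subst sum.reindex) (auto simp: inj_on_def neighbours_def)
  also have "\<dots> = (\<Sum>u\<in>neighbours V X \<rho>. vertex_sign (insert u \<rho>) u * F (insert u \<rho>))"
    by (intro sum.cong refl) (auto simp: incidence_insert neighbours_def)
  finally show ?thesis .
qed


section \<open>Links, double counting and signs\<close>

lemma link_simplicial_complex: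
  assumes X: "simplicial_complex V X" and \<eta>: "\<eta> \<in> X"
  shows "simplicial_complex V (link X \<eta>)"
  unfolding simplicial_complex_def
proof (intro conjI ballI allI impI)
  show "finite V" "link X \<eta> \<subseteq> Pow V" "{} \<in> link X \<eta>"
    using assms by (auto simp: simplicial_complex_def link_def)
  fix \<tau> \<sigma> assume "\<tau> \<in> link X \<eta>" "\<sigma> \<subseteq> \<tau>"
  then show "\<sigma> \<in> link X \<eta>"
    using simplicial_complex_subset[OF X, of \<tau> \<sigma>] simplicial_complex_subset[OF X, of "\<tau> \<union> \<eta>" "\<sigma> \<union> \<eta>"]
    by (auto simp: link_def)
qed

text \<open>This is why the lower Laplacian yields no correction term: the vertex sum of \<rho> in
  the link runs over the same vertices as that of \<rho> \<union> \<eta> in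
  \<open>X\<close>.\<close>

lemma neighbours_link:
  assumes X: "simplicial_complex V X" and \<rho>: "\<rho> \<in> link X \<eta>"
  shows "neighbours V (link X \<eta>) \<rho> = neighbours V X (\<rho> \<union> \<eta>)"
proof -
  have "insert u \<rho> \<in> X" if "insert u (\<rho> \<union> \<eta>) \<in> X" for u
    by (rule simplicial_complex_subset[OF X that]) auto
  then show ?thesis
    using \<rho> by (auto simp: neighbours_def link_def)
qed

text \<open>Double counting through the bijection that sends (\<eta>, \<tau>) to (\<tau> \<union>
  \<eta>, \<eta>). Sizes add, (l+1) + (m+1), which gives dimension l + m + 1.\<close>

lemma sum_faces_link:
  fixes F :: "'a set \<Rightarrow> 'a set \<Rightarrow> real"
  assumes X: "simplicial_complex V X"
  shows "(\<Sum>\<eta>\<in>faces X l. \<Sum>\<tau>\<in>faces (link X \<eta>) m. F \<eta> (\<tau> \<union> \<eta>))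
    = (\<Sum>\<tau>\<in>faces X (l + m + 1). \<Sum>\<eta> | \<eta> \<subseteq> \<tau> \<and> int (card \<eta>) = l + 1. F \<eta> \<tau>)"
proof -
  note fin = simplicial_complex_finite[OF X]
  have fin_link: "finite (faces (link X \<eta>) m)" for \<eta>
    using fin(2) by (simp add: faces_def link_def)
  have fin_sub: "finite {\<eta>. \<eta> \<subseteq> \<tau> \<and> int (card \<eta>) = l + 1}" if "\<tau> \<in> faces X (l + m + 1)" for \<tau>
    using that fin(3) by (auto simp: faces_def)
  have card_Un: "card (\<tau> \<union> \<eta>) = card \<tau> + card \<eta>" if "\<tau> \<in> link X \<eta>" "\<eta> \<in> X" for \<tau> \<eta>
    using that fin(3) by (intro card_Un_disjoint) (auto simp: link_def)
  have card_Diff: "int (card (\<tau> - \<eta>)) = int (card \<tau>) - int (card \<eta>)" if "\<tau> \<in> X" "\<eta> \<subseteq> \<tau>" for \<tau> \<eta>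
  proof -
    have "finite \<tau>" using that fin(3) by blast
    then show ?thesis
      using that card_mono[of \<tau> \<eta>] by (simp add: card_Diff_subset finite_subset[of \<eta> \<tau>] of_nat_diff)
  qed
  note sub = simplicial_complex_subset[OF X]
  have "(\<Sum>\<eta>\<in>faces X l. \<Sum>\<tau>\<in>faces (link X \<eta>) m. F \<eta> (\<tau> \<union> \<eta>))
      = (\<Sum>(\<eta>, \<tau>)\<in>Sigma (faces X l) (\<lambda>\<eta>. faces (link X \<eta>) m). F \<eta> (\<tau> \<union> \<eta>))"
    using fin_link by (intro sum.Sigma[OF fin(4)]) auto
  also have "\<dots> = (\<Sum>(\<tau>, \<eta>)\<in>Sigma (faces X (l + m + 1)) (\<lambda>\<tau>. {\<eta>. \<eta> \<subseteq> \<tau> \<and> int (card \<eta>) = l + 1}). F \<eta> \<tau>)"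
  proof (rule sum.reindex_bij_witness
      [of _ "\<lambda>(\<tau>, \<eta>). (\<eta>, \<tau> - \<eta>)" "\<lambda>(\<eta>, \<tau>). (\<tau> \<union> \<eta>, \<eta>)"], goal_cases)
    case (1 a)
    then show ?case by (auto simp: faces_def link_def)
  next
    case (2 a)
    then show ?case by (auto simp: faces_def card_Un) (auto simp: link_def)
  next
    case (3 b)
    then show ?case by auto
  next
    case (4 b)
    then obtain \<tau> \<eta> where b: "b = (\<tau>, \<eta>)" "\<tau> \<in> X" "\<eta> \<subseteq> \<tau>" "int (card \<tau>) = l + m + 2" "int (card \<eta>) = l + 1"
      by (auto simp: faces_def)
    moreover have "\<eta> \<in> X" "\<tau> - \<eta> \<in> X" using b by (auto intro: sub)
    ultimately show ?case by (auto simp: faces_def link_def card_Diff Un_absorb2)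
  next
    case (5 a)
    then show ?case by auto
  qed
  also have "\<dots> = (\<Sum>\<tau>\<in>faces X (l + m + 1). \<Sum>\<eta> | \<eta> \<subseteq> \<tau> \<and> int (card \<eta>) = l + 1. F \<eta> \<tau>)"
    using fin_sub by (intro sum.Sigma[OF fin(4), symmetric]) auto
  finally show ?thesis .
qed

lemma card_subsets_of_card_avoiding:
  assumes "finite \<tau>" "A \<subseteq> \<tau>"
  shows "card {\<eta>. \<eta> \<subseteq> \<tau> \<and> card \<eta> = p \<and> \<eta> \<inter> A = {}} = (card \<tau> - card A) choose p"
proof -
  have "{\<eta>. \<eta> \<subseteq> \<tau> \<and> card \<eta> = p \<and> \<eta> \<inter> A = {}} = {\<eta>. \<eta> \<subseteq> \<tau> - A \<and> card \<eta> = p}" by auto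
  then show ?thesis
    using assms n_subsets[of "\<tau> - A" p] by (simp add: card_Diff_subset finite_subset)
qed

text \<open>After the square is expanded, \<open>a u * a v\<close> is counted once for every subset
  that avoids both vertices, and this number depends only on whether u = v.\<close>

lemma sum_subsets_complement_square:
  fixes a :: "'a \<Rightarrow> real"
  assumes fin: "finite \<tau>" and n: "card \<tau> = n + 2"
  shows "(\<Sum>\<eta> | \<eta> \<subseteq> \<tau> \<and> card \<eta> = Suc p. (\<Sum>u\<in>\<tau> - \<eta>. a u)\<^sup>2)
    = real (n choose Suc p) * (\<Sum>u\<in>\<tau>. a u)\<^sup>2 + real (n choose p) * (\<Sum>u\<in>\<tau>. (a u)\<^sup>2)"
proof -
  let ?P = "{\<eta>. \<eta> \<subseteq> \<tau> \<and> card \<eta> = Suc p}"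
  have finP: "finite ?P" using fin by simp
  have "(\<Sum>u\<in>\<tau> - \<eta>. a u)\<^sup>2 = (\<Sum>u\<in>\<tau>. \<Sum>v\<in>\<tau>. if \<eta> \<inter> {u, v} = {} then a u * a v else 0)" for \<eta>
  proof -
    have "(\<Sum>u\<in>\<tau> - \<eta>. a u) = (\<Sum>u\<in>\<tau>. if u \<in> \<eta> then 0 else a u)"
      using fin by (intro sum.mono_neutral_cong_left) auto
    then show ?thesis
      unfolding power2_eq_square by (simp add: sum_product) (intro sum.cong refl, auto)
  qed
  then have "(\<Sum>\<eta>\<in>?P. (\<Sum>u\<in>\<tau> - \<eta>. a u)\<^sup>2)
      = (\<Sum>\<eta>\<in>?P. \<Sum>u\<in>\<tau>. \<Sum>v\<in>\<tau>. if \<eta> \<inter> {u, v} = {} then a u * a v else 0)"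
    by simp
  also have "\<dots> = (\<Sum>u\<in>\<tau>. \<Sum>v\<in>\<tau>. \<Sum>\<eta>\<in>?P. if \<eta> \<inter> {u, v} = {} then a u * a v else 0)"
    by (simp only: sum.swap[of _ \<tau> ?P])
  also have "\<dots> = (\<Sum>u\<in>\<tau>. \<Sum>v\<in>\<tau>. real (n choose Suc p) * (a u * a v)
      + (if v = u then real (n choose p) * (a u)\<^sup>2 else 0))"
  proof (intro sum.cong refl)
    fix u v assume uv: "u \<in> \<tau>" "v \<in> \<tau>"
    have "(\<Sum>\<eta>\<in>?P. if \<eta> \<inter> {u, v} = {} then a u * a v else 0)
        = (\<Sum>\<eta> | \<eta> \<subseteq> \<tau> \<and> card \<eta> = Suc p \<and> \<eta> \<inter> {u, v} = {}. a u * a v)"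
      using finP by (intro sum.mono_neutral_cong_right) auto
    also have "\<dots> = real ((card \<tau> - card {u, v}) choose Suc p) * (a u * a v)"
      using card_subsets_of_card_avoiding[OF fin, of "{u, v}" "Suc p"] uv by simp
    \<comment> \<open>For u = v the count is C(n+1, p+1), and Pascal's rule splits off the extra
      C(n, p).\<close>
    also have "\<dots> = real (n choose Suc p) * (a u * a v)
      + (if v = u then real (n choose p) * (a u)\<^sup>2 else 0)"
      using n by (cases "u = v") (auto simp: algebra_simps power2_eq_square)
    finally show "(\<Sum>\<eta>\<in>?P. if \<eta> \<inter> {u, v} = {} then a u * a v else 0) = real (n choose Suc p) * (a u * a v)
      + (if v = u then real (n choose p) * (a u)\<^sup>2 else 0)" .
  qed
  also have "\<dots> = real (n choose Suc p) * (\<Sum>u\<in>\<tau>. a u)\<^sup>2 + real (n choose p) * (\<Sum>u\<in>\<tau>. (a u)\<^sup>2)"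
    using fin by (simp add: sum.distrib power2_eq_square sum_product) (simp add: sum_distrib_left)
  finally show ?thesis .
qed

text \<open>Regroups pairs of a (k+1)-face and one of its vertices by the k-face that remains; this
  turns the diagonal surplus into weighted degrees of k-faces.\<close>

lemma sum_faces_vertices:
  fixes F :: "'a set \<Rightarrow> 'a set \<Rightarrow> real"
  assumes X: "simplicial_complex V X"
  shows "(\<Sum>\<tau>\<in>faces X (k + 1). \<Sum>u\<in>\<tau>. F \<tau> (\<tau> - {u}))
    = (\<Sum>\<sigma>\<in>faces X k. \<Sum>v\<in>neighbours V X \<sigma>. F (\<sigma> \<union> {v}) \<sigma>)"
proof -
  note fin = simplicial_complex_finite[OF X]
  have XV: "\<tau> \<subseteq> V" if "\<tau> \<in> X" for \<tau> using X that by (auto simp: simplicial_complex_def)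
  have fin1: "finite \<tau>" if "\<tau> \<in> faces X (k + 1)" for \<tau> using that fin by (auto simp: faces_def)
  have fin2: "finite (neighbours V X \<sigma>)" for \<sigma> using fin by (simp add: neighbours_def)
  have "(\<Sum>\<tau>\<in>faces X (k + 1). \<Sum>u\<in>\<tau>. F \<tau> (\<tau> - {u}))
      = (\<Sum>(\<tau>, u)\<in>Sigma (faces X (k + 1)) (\<lambda>\<tau>. \<tau>). F \<tau> (\<tau> - {u}))"
    using fin1 by (intro sum.Sigma[OF fin(4)]) auto
  also have "\<dots> = (\<Sum>(\<sigma>, v)\<in>Sigma (faces X k) (neighbours V X). F (\<sigma> \<union> {v}) \<sigma>)"
  proof (rule sum.reindex_bij_witness
      [of _ "\<lambda>(\<sigma>, v). (insert v \<sigma>, v)" "\<lambda>(\<tau>, u). (\<tau> - {u}, u)"], goal_cases)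
    case (1 a)
    then show ?case by auto
  next
    case (2 a)
    then obtain \<tau> u where a: "a = (\<tau>, u)" "\<tau> \<in> X" "u \<in> \<tau>" "int (card \<tau>) = k + 2"
      by (auto simp: faces_def)
    moreover have "\<tau> - {u} \<in> X" by (rule simplicial_complex_subset[OF X a(2)]) auto
    ultimately show ?case
      using XV by (auto simp: faces_def neighbours_def int_card_Diff_singleton fin(3) insert_absorb
          simp del: card_Diff_insert card_Diff_singleton)
  next
    case (3 b)
    then show ?case by (auto simp: neighbours_def)
  next
    case (4 b)
    then show ?case using fin(3) by (auto simp: neighbours_def faces_def)
  next
    case (5 a)
    then show ?case by (auto simp: insert_absorb)
  qed
  also have "\<dots> = (\<Sum>\<sigma>\<in>faces X k. \<Sum>v\<in>neighbours V X \<sigma>. F (\<sigma> \<union> {v}) \<sigma>)"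
    using fin2 by (intro sum.Sigma[OF fin(4), symmetric]) auto
  finally show ?thesis .
qed

text \<open>The sign of the permutation that sorts \<open>\<sigma>\<close> followed by \<open>\<eta>\<close>; it turns incidence signs of the link
  into those of the complex.\<close>

definition link_sign :: "'a::linorder set \<Rightarrow> 'a set \<Rightarrow> real" where
  "link_sign \<eta> \<sigma> = (\<Prod>u\<in>\<sigma>. vertex_sign \<eta> u)"

lemma link_sign_square [simp]: "(link_sign \<eta> \<sigma>)\<^sup>2 = 1"
  by (simp add: link_sign_def power2_eq_square flip: prod.distrib)

definition localize :: "('a::linorder set \<Rightarrow> real) \<Rightarrow> 'a set \<Rightarrow> 'a set \<Rightarrow> real" where
  "localize f \<eta> \<sigma> = link_sign \<eta> \<sigma> * f (\<sigma> \<union> \<eta>)"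

text \<open>Removing \<open>u\<close> from \<tau> changes \<open>link_sign\<close> by
  \<open>vertex_sign \<eta> u\<close>, exactly the factor between the sign of \<open>u\<close> in
  \<tau> and in \<tau> \<union> \<eta>. What is left is one global sign, which disappears on
  squaring.\<close>

lemma localize_boundary:
  assumes "finite \<tau>" "finite \<eta>" "\<tau> \<inter> \<eta> = {}"
  shows "(\<Sum>u\<in>\<tau>. vertex_sign \<tau> u * localize f \<eta> (\<tau> - {u}))
    = link_sign \<eta> \<tau> * (\<Sum>u\<in>\<tau>. vertex_sign (\<tau> \<union> \<eta>) u * f (\<tau> \<union> \<eta> - {u}))"
  unfolding sum_distrib_left
proof (rule sum.cong[OF refl])
  fix u assume u: "u \<in> \<tau>"
  then have "\<tau> - {u} \<union> \<eta> = \<tau> \<union> \<eta> - {u}" using assms by auto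
  moreover have "link_sign \<eta> \<tau> = vertex_sign \<eta> u * link_sign \<eta> (\<tau> - {u})"
    using assms(1) u by (simp add: link_sign_def prod.remove)
  ultimately show "vertex_sign \<tau> u * localize f \<eta> (\<tau> - {u})
      = link_sign \<eta> \<tau> * (vertex_sign (\<tau> \<union> \<eta>) u * f (\<tau> \<union> \<eta> - {u}))"
    using vertex_sign_square[of \<eta> u] by (simp add: vertex_sign_union[OF assms] localize_def) algebra
qed

text \<open>The same cancellation for added vertices. \<open>N\<close> is kept abstract so that the
  neighbours of \<rho> \<union> \<eta> in the whole complex can be inserted.\<close>

lemma localize_coboundary:
  assumes "finite \<rho>" "finite \<eta>" "\<rho> \<inter> \<eta> = {}" "N \<inter> (\<rho> \<union> \<eta>) = {}"
  shows "(\<Sum>u\<in>N. vertex_sign (insert u \<rho>) u * (link_weight w \<eta> (insert u \<rho>) * localize f \<eta> (insert u \<rho>)))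
    = link_sign \<eta> \<rho> * (\<Sum>u\<in>N. vertex_sign (insert u (\<rho> \<union> \<eta>)) u
        * (w (insert u (\<rho> \<union> \<eta>)) * f (insert u (\<rho> \<union> \<eta>))))"
  unfolding sum_distrib_left
proof (rule sum.cong[OF refl])
  fix u assume u: "u \<in> N"
  then have "vertex_sign (insert u (\<rho> \<union> \<eta>)) u = vertex_sign (insert u \<rho>) u * vertex_sign \<eta> u"
    using assms vertex_sign_union[of "insert u \<rho>" \<eta> u] by auto
  moreover have "link_sign \<eta> (insert u \<rho>) = vertex_sign \<eta> u * link_sign \<eta> \<rho>"
    using assms u by (subst link_sign_def, subst prod.insert) (auto simp: link_sign_def)
  ultimately show "vertex_sign (insert u \<rho>) u * (link_weight w \<eta> (insert u \<rho>) * localize f \<eta> (insert u \<rho>))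
      = link_sign \<eta> \<rho> * (vertex_sign (insert u (\<rho> \<union> \<eta>)) u
        * (w (insert u (\<rho> \<union> \<eta>)) * f (insert u (\<rho> \<union> \<eta>))))"
    by (simp add: link_weight_def localize_def mult_ac)
qed

text \<open>The right-hand side depends on the faces of the link only through their union with
  \<eta>, the shape that \<open>sum_faces_link\<close> requires. For this reason \<tau> is written
  as \<tau> \<union> \<eta> - \<eta>.\<close>

lemma link_quadratic_form:
  assumes X: "simplicial_complex V X" and w: "\<forall>\<sigma>\<in>X. w \<sigma> > 0" and \<eta>: "\<eta> \<in> X"
  shows "(\<Sum>\<sigma>\<in>faces (link X \<eta>) m. link_weight w \<eta> \<sigma> * localize f \<eta> \<sigma> *
        (\<Sum>\<sigma>'\<in>faces (link X \<eta>) m. laplacian_kernel (link X \<eta>) (link_weight w \<eta>) m \<sigma> \<sigma>' * localize f \<eta> \<sigma>'))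
    = (\<Sum>\<tau>\<in>faces (link X \<eta>) (m + 1). w (\<tau> \<union> \<eta>) *
        (\<Sum>u\<in>\<tau> \<union> \<eta> - \<eta>. vertex_sign (\<tau> \<union> \<eta>) u * f (\<tau> \<union> \<eta> - {u}))\<^sup>2)
    + (\<Sum>\<rho>\<in>faces (link X \<eta>) (m - 1). inverse (w (\<rho> \<union> \<eta>)) *
        (\<Sum>u\<in>neighbours V X (\<rho> \<union> \<eta>). vertex_sign (insert u (\<rho> \<union> \<eta>)) u
          * (w (insert u (\<rho> \<union> \<eta>)) * f (insert u (\<rho> \<union> \<eta>))))\<^sup>2)"
proof -
  note lk = link_simplicial_complex[OF X \<eta>]
  note fin = simplicial_complex_finite(3)[OF X]
  have "\<forall>\<sigma>\<in>faces (link X \<eta>) m. link_weight w \<eta> \<sigma> > 0"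
    using w by (auto simp: link_weight_def faces_def link_def)
  note form = laplacian_quadratic_form[OF this]
  show ?thesis
    unfolding form
  proof (intro arg_cong2[of _ _ _ _ "(+)"] sum.cong refl)
    fix \<tau> assume \<tau>: "\<tau> \<in> faces (link X \<eta>) (m + 1)"
    then have t: "finite \<tau>" "finite \<eta>" "\<tau> \<inter> \<eta> = {}" using \<eta> fin by (auto simp: faces_def link_def)
    then have "\<tau> \<union> \<eta> - \<eta> = \<tau>" by auto
    then show "link_weight w \<eta> \<tau> * (\<Sum>\<sigma>\<in>faces (link X \<eta>) m. incidence \<tau> \<sigma> * localize f \<eta> \<sigma>)\<^sup>2
        = w (\<tau> \<union> \<eta>) * (\<Sum>u\<in>\<tau> \<union> \<eta> - \<eta>. vertex_sign (\<tau> \<union> \<eta>) u * f (\<tau> \<union> \<eta> - {u}))\<^sup>2"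
      unfolding sum_incidence_boundary[OF lk \<tau>] localize_boundary[OF t]
      by (simp add: power_mult_distrib link_weight_def)
  next
    fix \<rho> assume \<rho>: "\<rho> \<in> faces (link X \<eta>) (m - 1)"
    then have r: "finite \<rho>" "finite \<eta>" "\<rho> \<inter> \<eta> = {}" "\<rho> \<in> link X \<eta>"
      using \<eta> fin by (auto simp: faces_def link_def)
    have N: "neighbours V X (\<rho> \<union> \<eta>) \<inter> (\<rho> \<union> \<eta>) = {}" by (auto simp: neighbours_def)
    show "inverse (link_weight w \<eta> \<rho>) *
        (\<Sum>\<sigma>\<in>faces (link X \<eta>) m. incidence \<sigma> \<rho> * (link_weight w \<eta> \<sigma> * localize f \<eta> \<sigma>))\<^sup>2
      = inverse (w (\<rho> \<union> \<eta>)) * (\<Sum>u\<in>neighbours V X (\<rho> \<union> \<eta>). vertex_sign (insert u (\<rho> \<union> \<eta>)) u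
          * (w (insert u (\<rho> \<union> \<eta>)) * f (insert u (\<rho> \<union> \<eta>))))\<^sup>2"
      unfolding sum_incidence_coboundary[OF lk \<rho>] neighbours_link[OF X r(4)] localize_coboundary[OF r(1-3) N]
      by (simp add: power_mult_distrib link_weight_def)
  qed
qed

text \<open>The upper parts add up by the count of pairs of avoided vertices, the lower parts by a
  plain count of subsets. \<open>K\<close> and \<open>L\<close> are natural numbers for the
  binomials; \<open>m\<close> is an integer because dimension \<open>m - 1\<close> can be
  -1.\<close>

lemma sum_link_quadratic_forms:
  assumes X: "simplicial_complex V X" and w: "\<forall>\<sigma>\<in>X. w \<sigma> > 0"
    and m: "m = int K - int L - 1"
  shows "(\<Sum>\<eta>\<in>faces X (int L). \<Sum>\<sigma>\<in>faces (link X \<eta>) m. link_weight w \<eta> \<sigma> * localize f \<eta> \<sigma> *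
        (\<Sum>\<sigma>'\<in>faces (link X \<eta>) m. laplacian_kernel (link X \<eta>) (link_weight w \<eta>) m \<sigma> \<sigma>' * localize f \<eta> \<sigma>'))
    = real (K choose Suc L) * (\<Sum>\<sigma>\<in>faces X (int K). w \<sigma> * f \<sigma> *
        (\<Sum>\<sigma>'\<in>faces X (int K). laplacian_kernel X w (int K) \<sigma> \<sigma>' * f \<sigma>'))
    + real (K choose L) * (\<Sum>\<sigma>\<in>faces X (int K). (f \<sigma>)\<^sup>2 * (\<Sum>v\<in>neighbours V X \<sigma>. w (\<sigma> \<union> {v})))"
proof -
  define U where "U \<tau> = (\<Sum>u\<in>\<tau>. vertex_sign \<tau> u * f (\<tau> - {u}))" for \<tau>
  define D where "D \<rho> = inverse (w \<rho>) * (\<Sum>u\<in>neighbours V X \<rho>. vertex_sign (insert u \<rho>) u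
    * (w (insert u \<rho>) * f (insert u \<rho>)))\<^sup>2" for \<rho>
  note fin = simplicial_complex_finite[OF X]
  have wK: "\<forall>\<sigma>\<in>faces X (int K). w \<sigma> > 0" using w by (simp add: faces_def)
  have Q: "(\<Sum>\<sigma>\<in>faces X (int K). w \<sigma> * f \<sigma> * (\<Sum>\<sigma>'\<in>faces X (int K). laplacian_kernel X w (int K) \<sigma> \<sigma>' * f \<sigma>'))
      = (\<Sum>\<tau>\<in>faces X (int K + 1). w \<tau> * (U \<tau>)\<^sup>2) + (\<Sum>\<rho>\<in>faces X (int K - 1). D \<rho>)"
    unfolding laplacian_quadratic_form[OF wK]
    by (intro arg_cong2[of _ _ _ _ "(+)"] sum.cong refl)
      (simp_all only: sum_incidence_boundary[OF X] sum_incidence_coboundary[OF X] U_def D_def)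
  have eqU: "int L + (m + 1) + 1 = int K + 1" and eqD: "int L + (m - 1) + 1 = int K - 1"
    using m by auto
  have "(\<Sum>\<eta>\<in>faces X (int L). \<Sum>\<sigma>\<in>faces (link X \<eta>) m. link_weight w \<eta> \<sigma> * localize f \<eta> \<sigma> *
        (\<Sum>\<sigma>'\<in>faces (link X \<eta>) m. laplacian_kernel (link X \<eta>) (link_weight w \<eta>) m \<sigma> \<sigma>' * localize f \<eta> \<sigma>'))
    = (\<Sum>\<eta>\<in>faces X (int L). (\<Sum>\<tau>\<in>faces (link X \<eta>) (m + 1). w (\<tau> \<union> \<eta>) *
        (\<Sum>u\<in>\<tau> \<union> \<eta> - \<eta>. vertex_sign (\<tau> \<union> \<eta>) u * f (\<tau> \<union> \<eta> - {u}))\<^sup>2)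
      + (\<Sum>\<rho>\<in>faces (link X \<eta>) (m - 1). D (\<rho> \<union> \<eta>)))"
    by (rule sum.cong[OF refl], subst link_quadratic_form[OF X w]) (auto simp: D_def faces_def)
  also have "\<dots> = (\<Sum>\<tau>\<in>faces X (int K + 1). \<Sum>\<eta> | \<eta> \<subseteq> \<tau> \<and> int (card \<eta>) = int L + 1.
        w \<tau> * (\<Sum>u\<in>\<tau> - \<eta>. vertex_sign \<tau> u * f (\<tau> - {u}))\<^sup>2)
      + (\<Sum>\<rho>\<in>faces X (int K - 1). \<Sum>\<eta> | \<eta> \<subseteq> \<rho> \<and> int (card \<eta>) = int L + 1. D \<rho>)"
    unfolding sum.distrib
      sum_faces_link[OF X, of "\<lambda>\<eta> \<tau>. w \<tau> * (\<Sum>u\<in>\<tau> - \<eta>. vertex_sign \<tau> u * f (\<tau> - {u}))\<^sup>2"]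
      sum_faces_link[OF X, of "\<lambda>\<eta>. D"] eqU eqD ..
  \<comment> \<open>A face of dimension \<open>K + 1\<close> has \<open>K + 2\<close> vertices, so
    the count of avoided vertices applies with \<open>n = K\<close>; the signs disappear from the
    diagonal squares.\<close>
  also have "(\<Sum>\<tau>\<in>faces X (int K + 1). \<Sum>\<eta> | \<eta> \<subseteq> \<tau> \<and> int (card \<eta>) = int L + 1.
        w \<tau> * (\<Sum>u\<in>\<tau> - \<eta>. vertex_sign \<tau> u * f (\<tau> - {u}))\<^sup>2)
      = (\<Sum>\<tau>\<in>faces X (int K + 1). real (K choose Suc L) * (w \<tau> * (U \<tau>)\<^sup>2)
          + real (K choose L) * (\<Sum>u\<in>\<tau>. w \<tau> * (f (\<tau> - {u}))\<^sup>2))"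
  proof (rule sum.cong[OF refl])
    fix \<tau> assume "\<tau> \<in> faces X (int K + 1)"
    then have t: "finite \<tau>" "card \<tau> = K + 2" using fin by (auto simp: faces_def)
    have "int (card \<eta>) = int L + 1 \<longleftrightarrow> card \<eta> = Suc L" for \<eta> :: "'a set" by auto
    moreover have "(vertex_sign \<tau> u)\<^sup>2 = 1" for u by (simp add: power2_eq_square)
    ultimately show "(\<Sum>\<eta> | \<eta> \<subseteq> \<tau> \<and> int (card \<eta>) = int L + 1.
        w \<tau> * (\<Sum>u\<in>\<tau> - \<eta>. vertex_sign \<tau> u * f (\<tau> - {u}))\<^sup>2)
      = real (K choose Suc L) * (w \<tau> * (U \<tau>)\<^sup>2) + real (K choose L) * (\<Sum>u\<in>\<tau>. w \<tau> * (f (\<tau> - {u}))\<^sup>2)"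
      using sum_subsets_complement_square[OF t, where p = L and a = "\<lambda>u. vertex_sign \<tau> u * f (\<tau> - {u})"]
      by (simp add: U_def power_mult_distrib algebra_simps flip: sum_distrib_left)
  qed
  \<comment> \<open>The summand does not depend on \<eta>, and a face of dimension
    \<open>K - 1\<close> has \<open>K\<close> vertices.\<close>
  also have "(\<Sum>\<rho>\<in>faces X (int K - 1). \<Sum>\<eta> | \<eta> \<subseteq> \<rho> \<and> int (card \<eta>) = int L + 1. D \<rho>)
      = real (K choose Suc L) * (\<Sum>\<rho>\<in>faces X (int K - 1). D \<rho>)"
    unfolding sum_distrib_left
  proof (rule sum.cong[OF refl])
    fix \<rho> assume "\<rho> \<in> faces X (int K - 1)"
    then have "finite \<rho>" "card \<rho> = K" using fin by (auto simp: faces_def)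
    moreover have "int (card \<eta>) = int L + 1 \<longleftrightarrow> card \<eta> = Suc L" for \<eta> :: "'a set" by auto
    ultimately show "(\<Sum>\<eta> | \<eta> \<subseteq> \<rho> \<and> int (card \<eta>) = int L + 1. D \<rho>) = real (K choose Suc L) * D \<rho>"
      by (simp add: n_subsets)
  qed
  also have "(\<Sum>\<tau>\<in>faces X (int K + 1). real (K choose Suc L) * (w \<tau> * (U \<tau>)\<^sup>2)
          + real (K choose L) * (\<Sum>u\<in>\<tau>. w \<tau> * (f (\<tau> - {u}))\<^sup>2))
      = real (K choose Suc L) * (\<Sum>\<tau>\<in>faces X (int K + 1). w \<tau> * (U \<tau>)\<^sup>2)
        + real (K choose L) * (\<Sum>\<sigma>\<in>faces X (int K). \<Sum>v\<in>neighbours V X \<sigma>. w (\<sigma> \<union> {v}) * (f \<sigma>)\<^sup>2)"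
    unfolding sum.distrib sum_faces_vertices[OF X, of "\<lambda>\<tau> \<sigma>. w \<tau> * (f \<sigma>)\<^sup>2", symmetric]
    by (simp add: sum_distrib_left)
  finally show ?thesis
    unfolding Q by (simp add: algebra_simps sum_distrib_left sum_distrib_right)
qed

lemma sum_localize_norm:
  assumes X: "simplicial_complex V X" and m: "m = int K - int L - 1"
  shows "(\<Sum>\<eta>\<in>faces X (int L). \<Sum>\<sigma>\<in>faces (link X \<eta>) m. link_weight w \<eta> \<sigma> * (localize f \<eta> \<sigma>)\<^sup>2)
    = real (Suc K choose Suc L) * (\<Sum>\<sigma>\<in>faces X (int K). w \<sigma> * (f \<sigma>)\<^sup>2)"
proof -
  have eq: "int L + m + 1 = int K" using m by auto
  have "(\<Sum>\<eta>\<in>faces X (int L). \<Sum>\<sigma>\<in>faces (link X \<eta>) m. link_weight w \<eta> \<sigma> * (localize f \<eta> \<sigma>)\<^sup>2)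
    = (\<Sum>\<eta>\<in>faces X (int L). \<Sum>\<sigma>\<in>faces (link X \<eta>) m. w (\<sigma> \<union> \<eta>) * (f (\<sigma> \<union> \<eta>))\<^sup>2)"
    by (simp add: localize_def link_weight_def power_mult_distrib)
  also have "\<dots> = (\<Sum>\<sigma>\<in>faces X (int K). \<Sum>\<eta> | \<eta> \<subseteq> \<sigma> \<and> int (card \<eta>) = int L + 1. w \<sigma> * (f \<sigma>)\<^sup>2)"
    unfolding sum_faces_link[OF X, of "\<lambda>\<eta> \<sigma>. w \<sigma> * (f \<sigma>)\<^sup>2"] eq ..
  also have "\<dots> = (\<Sum>\<sigma>\<in>faces X (int K). real (Suc K choose Suc L) * (w \<sigma> * (f \<sigma>)\<^sup>2))"
  proof (rule sum.cong[OF refl])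
    fix \<sigma> assume "\<sigma> \<in> faces X (int K)"
    then have "finite \<sigma>" "card \<sigma> = Suc K"
      using simplicial_complex_finite(3)[OF X] by (auto simp: faces_def)
    moreover have "int (card \<eta>) = int L + 1 \<longleftrightarrow> card \<eta> = Suc L" for \<eta> :: "'a set" by auto
    ultimately show "(\<Sum>\<eta> | \<eta> \<subseteq> \<sigma> \<and> int (card \<eta>) = int L + 1. w \<sigma> * (f \<sigma>)\<^sup>2)
        = real (Suc K choose Suc L) * (w \<sigma> * (f \<sigma>)\<^sup>2)"
      by (simp add: n_subsets del: binomial_Suc_Suc)
  qed
  finally show ?thesis by (simp only: sum_distrib_left)
qed

lemma sum_degree_le:
  assumes X: "simplicial_complex V X" and w: "\<forall>\<sigma>\<in>X. w \<sigma> > 0"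
  shows "(\<Sum>\<sigma>\<in>faces X k. (f \<sigma>)\<^sup>2 * (\<Sum>v\<in>neighbours V X \<sigma>. w (\<sigma> \<union> {v})))
    \<le> max_degree V X w k * (\<Sum>\<sigma>\<in>faces X k. w \<sigma> * (f \<sigma>)\<^sup>2)"
  unfolding sum_distrib_left[of "max_degree V X w k"]
proof (rule sum_mono)
  fix \<sigma> assume \<sigma>: "\<sigma> \<in> faces X k"
  then have pos: "w \<sigma> > 0" using w by (simp add: faces_def)
  have "(\<Sum>v\<in>neighbours V X \<sigma>. w (\<sigma> \<union> {v}) / w \<sigma>) \<le> max_degree V X w k"
    unfolding max_degree_def using \<sigma> simplicial_complex_finite(4)[OF X] by (intro Max_ge) auto
  then have "(\<Sum>v\<in>neighbours V X \<sigma>. w (\<sigma> \<union> {v})) \<le> max_degree V X w k * w \<sigma>"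
    using pos by (simp add: field_simps flip: sum_divide_distrib)
  from mult_right_mono[OF this, of "(f \<sigma>)\<^sup>2"]
  show "(f \<sigma>)\<^sup>2 * (\<Sum>v\<in>neighbours V X \<sigma>. w (\<sigma> \<union> {v})) \<le> max_degree V X w k * (w \<sigma> * (f \<sigma>)\<^sup>2)"
    by (simp add: mult_ac)
qed

section \<open>Assembly: the direct sum over links and the constants\<close>

lemma distinct_concat_Pair:
  assumes "distinct es" "\<And>e. e \<in> set es \<Longrightarrow> distinct (ys e)"
  shows "distinct (concat (map (\<lambda>e. map (Pair e) (ys e)) es))"
  using assms by (induction es) (auto simp: distinct_map inj_on_def)

text \<open>Ensures that the direct sum has at least \<open>i\<close> eigenvalues, since
  \<open>nth_eigenvalue\<close> beyond the end of the list is unspecified. Every k-face contains an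
  l-face, so taking unions maps the pairs onto the k-faces.\<close>

lemma card_faces_le_link_faces:
  assumes X: "simplicial_complex V X" and kl: "0 \<le> l" "l < k"
  shows "card (faces X k)
    \<le> card (Sigma {\<eta> \<in> faces X l. complex_dim (link X \<eta>) \<ge> k - l - 1} (\<lambda>\<eta>. faces (link X \<eta>) (k - l - 1)))"
    (is "_ \<le> card ?S")
proof (rule surj_card_le[where f = "\<lambda>(\<eta>, \<sigma>). \<sigma> \<union> \<eta>"])
  note fin = simplicial_complex_finite[OF X]
  have "finite (faces (link X \<eta>) (k - l - 1))" for \<eta> using fin(2) by (simp add: faces_def link_def)
  then show "finite ?S" using fin(4) by auto
  show "faces X k \<subseteq> (\<lambda>(\<eta>, \<sigma>). \<sigma> \<union> \<eta>) ` ?S"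
  proof
    fix \<tau> assume "\<tau> \<in> faces X k"
    then have \<tau>: "\<tau> \<in> X" "int (card \<tau>) = k + 1" "finite \<tau>" using fin(3) by (auto simp: faces_def)
    have "nat (l + 1) \<le> card \<tau>" using \<tau> kl by linarith
    then obtain \<eta> where \<eta>: "\<eta> \<subseteq> \<tau>" "card \<eta> = nat (l + 1)" "finite \<eta>"
      using obtain_subset_with_card_n by metis
    have sub: "\<eta> \<in> X" "\<tau> - \<eta> \<in> X" using simplicial_complex_subset[OF X \<tau>(1)] \<eta> by auto
    have "card (\<tau> - \<eta>) = card \<tau> - card \<eta>" using \<eta> by (simp add: card_Diff_subset)
    then have "int (card (\<tau> - \<eta>)) = k - l" using \<tau> \<eta> kl by linarith
    then have face: "\<tau> - \<eta> \<in> faces (link X \<eta>) (k - l - 1)"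
      using \<tau> \<eta> sub by (auto simp: faces_def link_def Un_absorb2)
    moreover have "finite (link X \<eta>)" using fin(2) by (simp add: link_def)
    ultimately have "complex_dim (link X \<eta>) \<ge> k - l - 1"
      using faces_empty_above_dim[of "link X \<eta>" "k - l - 1"] by force
    then have "(\<eta>, \<tau> - \<eta>) \<in> ?S" using face sub \<eta> kl by (auto simp: faces_def)
    moreover have "\<tau> = (\<lambda>(\<eta>, \<sigma>). \<sigma> \<union> \<eta>) (\<eta>, \<tau> - \<eta>)" using \<eta> by auto
    ultimately show "\<tau> \<in> (\<lambda>(\<eta>, \<sigma>). \<sigma> \<union> \<eta>) ` ?S" by (rule rev_image_eqI)
  qed
qed

lemma link_laplacian_sum_eq_kernel_mat:
  assumes X: "simplicial_complex V X"
  shows "link_laplacian_sum X w l k = kernel_mat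
    (concat (map (\<lambda>\<eta>. map (Pair \<eta>) (enum_list (faces (link X \<eta>) (k - l - 1))))
      (enum_list {\<eta> \<in> faces X l. complex_dim (link X \<eta>) \<ge> k - l - 1})))
    (\<lambda>(\<eta>, \<sigma>) (\<eta>', \<sigma>'). if \<eta> = \<eta>' then laplacian_kernel (link X \<eta>) (link_weight w \<eta>) (k - l - 1) \<sigma> \<sigma>' else 0)"
proof -
  have fin: "finite {\<eta> \<in> faces X l. complex_dim (link X \<eta>) \<ge> k - l - 1}"
    using simplicial_complex_finite(4)[OF X] by simp
  have "finite (link X \<eta>)" for \<eta> using simplicial_complex_finite(2)[OF X] by (simp add: link_def)
  then show ?thesis
    unfolding link_laplacian_sum_def
    by (simp add: laplacian_eq_kernel_mat diag_block_kernel_mat[OF enum_list(1)[OF fin]])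
qed

theorem theorem4p1:
  fixes V :: "'a::linorder set" and X :: "'a set set" and w :: "'a set \<Rightarrow> real"
    and k l :: int and i :: nat
  assumes "simplicial_complex V X"
    and "\<And>\<sigma>. \<sigma> \<in> X \<Longrightarrow> w \<sigma> > 0"
    and "0 \<le> l" and "l < k" and "k \<le> complex_dim X"
    and "1 \<le> i" and "i \<le> card (faces X k)"
  shows "of_int (k - l) * nth_eigenvalue (laplacian X w k) i
           \<ge> of_int (k + 1) * nth_eigenvalue (link_laplacian_sum X w l k) i
               - of_int (l + 1) * max_degree V X w k"
proof -
  note X = assms(1)
  have w: "\<forall>\<sigma>\<in>X. w \<sigma> > 0" using assms(2) by blast
  note fin = simplicial_complex_finite[OF X]
  define K L where "K = nat k" and "L = nat l"
  have K: "k = int K" and L: "l = int L" and LK: "L < K" using assms by (auto simp: K_def L_def)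
  define m where "m = k - l - 1"
  have m: "m = int K - int L - 1" by (simp add: m_def K L)
  define E where "E = {\<eta> \<in> faces X l. complex_dim (link X \<eta>) \<ge> m}"
  define ys where "ys = concat (map (\<lambda>\<eta>. map (Pair \<eta>) (enum_list (faces (link X \<eta>) m))) (enum_list E))"
  define h where "h = (\<lambda>(\<eta>, \<sigma>) (\<eta>', \<sigma>'). if \<eta> = \<eta>' then laplacian_kernel (link X \<eta>) (link_weight w \<eta>) m \<sigma> \<sigma>' else 0)"
  define e where "e = (\<lambda>(\<eta>, \<sigma>). link_weight w \<eta> \<sigma>)"
  define T where "T f = (\<lambda>(\<eta>, \<sigma>). localize f \<eta> \<sigma>)" for f :: "'a set \<Rightarrow> real"
  have finE: "finite E" using fin(4) by (simp add: E_def)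
  have fin_link: "finite (link X \<eta>)" "finite (faces (link X \<eta>) m)" for \<eta>
    using fin(2) by (auto simp: link_def faces_def)
  have set_ys: "set ys = Sigma E (\<lambda>\<eta>. faces (link X \<eta>) m)"
    using finE fin_link by (auto simp: ys_def enum_list)
  have dist_ys: "distinct ys"
    unfolding ys_def using finE fin_link by (intro distinct_concat_Pair enum_list)
  have E_sum: "(\<Sum>\<eta>\<in>E. \<Sum>\<sigma>\<in>faces (link X \<eta>) m. G \<eta> \<sigma>) = (\<Sum>\<eta>\<in>faces X (int L). \<Sum>\<sigma>\<in>faces (link X \<eta>) m. G \<eta> \<sigma>)"
    for G :: "'a set \<Rightarrow> 'a set \<Rightarrow> real"
  proof (rule sum.mono_neutral_left)
    show "\<forall>\<eta>\<in>faces X (int L) - E. (\<Sum>\<sigma>\<in>faces (link X \<eta>) m. G \<eta> \<sigma>) = 0"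
      using faces_empty_above_dim[OF fin_link(1)] by (auto simp: E_def L not_le)
  qed (use fin(4) in \<open>auto simp: E_def L\<close>)
  have sum_ys: "(\<Sum>y\<in>set ys. G y) = (\<Sum>\<eta>\<in>E. \<Sum>\<sigma>\<in>faces (link X \<eta>) m. G (\<eta>, \<sigma>))" for G :: "_ \<Rightarrow> real"
    unfolding set_ys using finE fin_link by (subst sum.Sigma) auto
  have w_link: "link_weight w \<eta> \<sigma> > 0" if "\<eta> \<in> E" "\<sigma> \<in> faces (link X \<eta>) m" for \<eta> \<sigma>
    using w that by (auto simp: link_weight_def E_def faces_def link_def)
  have Xk: "set (enum_list (faces X k)) = faces X k" "length (enum_list (faces X k)) = card (faces X k)"
    using fin(4) by (auto simp: enum_list)
  have "card (faces X k) \<le> length ys"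
    using card_faces_le_link_faces[OF X assms(3,4)] distinct_card[OF dist_ys]
    by (simp add: set_ys E_def m_def)
  then have i: "i \<le> length (enum_list (faces X k))" "i \<le> length ys" using assms(7) Xk by auto
  have "real (Suc K choose Suc L) * nth_eigenvalue (kernel_mat ys h) i
    \<le> real (K choose Suc L) * nth_eigenvalue (kernel_mat (enum_list (faces X k)) (laplacian_kernel X w k)) i
      + real (K choose L) * max_degree V X w k"
  proof (rule nth_eigenvalue_comparison[where d = w and e = e and T = T])
    show "distinct (enum_list (faces X k))" using fin(4) by (simp add: enum_list)
    show "w \<sigma> > 0" if "\<sigma> \<in> set (enum_list (faces X k))" for \<sigma>
      using that w Xk by (simp add: faces_def)
    then show "w \<sigma> * laplacian_kernel X w k \<sigma> \<sigma>' = w \<sigma>' * laplacian_kernel X w k \<sigma>' \<sigma>"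
      if "\<sigma> \<in> set (enum_list (faces X k))" "\<sigma>' \<in> set (enum_list (faces X k))" for \<sigma> \<sigma>'
      using that by (intro laplacian_kernel_symmetric)
    show "distinct ys" by (fact dist_ys)
    show "e y > 0" if "y \<in> set ys" for y
      using that w_link by (auto simp: set_ys e_def)
    show "e y * h y z = e z * h z y" if "y \<in> set ys" "z \<in> set ys" for y z
      using that laplacian_kernel_symmetric[of "link_weight w (fst y)" "snd y" "snd z"] w_link
      by (auto simp: set_ys e_def h_def)
    show "T (\<lambda>x. \<Sum>c<n. v c * q c x) y = (\<Sum>c<n. v c * T (q c) y)" for n :: nat and v q y
      by (cases y) (simp add: T_def localize_def sum_distrib_left mult_ac)
    show "(\<Sum>y\<in>set ys. e y * (T f y)\<^sup>2)
        = real (Suc K choose Suc L) * (\<Sum>\<sigma>\<in>set (enum_list (faces X k)). w \<sigma> * (f \<sigma>)\<^sup>2)" for f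
      using sum_localize_norm[OF X m, of w f]
      unfolding sum_ys Xk unfolding K by (simp add: e_def T_def E_sum del: binomial_Suc_Suc)
    show "(\<Sum>y\<in>set ys. e y * T f y * (\<Sum>z\<in>set ys. h y z * T f z))
        \<le> real (K choose Suc L) * (\<Sum>\<sigma>\<in>set (enum_list (faces X k)). w \<sigma> * f \<sigma> *
            (\<Sum>\<sigma>'\<in>set (enum_list (faces X k)). laplacian_kernel X w k \<sigma> \<sigma>' * f \<sigma>'))
          + real (K choose L) * max_degree V X w k * (\<Sum>\<sigma>\<in>set (enum_list (faces X k)). w \<sigma> * (f \<sigma>)\<^sup>2)" for f
    proof -
      \<comment> \<open>The kernel of the direct sum vanishes between different blocks, so only the
        block of \<eta> contributes.\<close>
      have inner: "(\<Sum>z\<in>set ys. h (\<eta>, \<sigma>) z * T f z)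
          = (\<Sum>\<sigma>'\<in>faces (link X \<eta>) m. laplacian_kernel (link X \<eta>) (link_weight w \<eta>) m \<sigma> \<sigma>' * localize f \<eta> \<sigma>')"
        if "\<eta> \<in> E" for \<eta> \<sigma>
      proof -
        have "(\<Sum>z\<in>set ys. h (\<eta>, \<sigma>) z * T f z) = (\<Sum>\<eta>'\<in>E. if \<eta>' = \<eta> then
            (\<Sum>\<sigma>'\<in>faces (link X \<eta>) m. laplacian_kernel (link X \<eta>) (link_weight w \<eta>) m \<sigma> \<sigma>' * localize f \<eta> \<sigma>') else 0)"
          unfolding sum_ys by (intro sum.cong refl) (auto simp: h_def T_def)
        then show ?thesis using that finE by simp
      qed
      have "(\<Sum>y\<in>set ys. e y * T f y * (\<Sum>z\<in>set ys. h y z * T f z))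
        = (\<Sum>\<eta>\<in>E. \<Sum>\<sigma>\<in>faces (link X \<eta>) m. link_weight w \<eta> \<sigma> * localize f \<eta> \<sigma> *
            (\<Sum>\<sigma>'\<in>faces (link X \<eta>) m. laplacian_kernel (link X \<eta>) (link_weight w \<eta>) m \<sigma> \<sigma>' * localize f \<eta> \<sigma>'))"
        unfolding sum_ys[of "\<lambda>y. e y * T f y * (\<Sum>z\<in>set ys. h y z * T f z)"]
        by (intro sum.cong refl, simp only: inner) (simp add: e_def T_def)
      then show ?thesis
        using mult_left_mono[OF sum_degree_le[OF X w, of f k], of "real (K choose L)"]
        unfolding E_sum sum_link_quadratic_forms[OF X w m] Xk unfolding K by (simp add: mult_ac)
    qed
  qed (use assms(6) i in auto)
  then have cmp: "real (Suc K choose Suc L) * nth_eigenvalue (link_laplacian_sum X w l k) i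
    \<le> real (K choose Suc L) * nth_eigenvalue (laplacian X w k) i + real (K choose L) * max_degree V X w k"
    unfolding laplacian_eq_kernel_mat[OF fin(2)] link_laplacian_sum_eq_kernel_mat[OF X]
      ys_def h_def E_def m_def .
  \<comment> \<open>The absorption identities express \<open>K + 1\<close> times either remaining
    binomial as a multiple of \<open>c\<close>. So the comparison is multiplied by
    \<open>K + 1\<close> and \<open>c\<close> is cancelled, which avoids fractions.\<close>
  define c where "c = real (Suc K choose Suc L)"
  have c: "c > 0" using LK by (simp add: c_def del: binomial_Suc_Suc)
  have "Suc K * (K choose L) = Suc L * (Suc K choose Suc L)"
    by (simp only: Suc_times_binomial)
  then have c1: "real (Suc K) * real (K choose L) = real (Suc L) * c"
    unfolding c_def of_nat_mult[symmetric] by (simp only:)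
  have "Suc K * (K choose Suc L) = (K - L) * (Suc K choose Suc L)"
    using binomial_absorb_comp[of "Suc K" "Suc L"] by (simp del: binomial_Suc_Suc)
  then have c2: "real (Suc K) * real (K choose Suc L) = real (K - L) * c"
    unfolding c_def of_nat_mult[symmetric] by (simp only:)
  let ?B = "nth_eigenvalue (link_laplacian_sum X w l k) i" and ?A = "nth_eigenvalue (laplacian X w k) i"
  have "c * (real (Suc K) * ?B) = real (Suc K) * (c * ?B)" by (simp only: mult_ac)
  also have "\<dots> \<le> real (Suc K) * (real (K choose Suc L) * ?A + real (K choose L) * max_degree V X w k)"
    using cmp by (intro mult_left_mono) (auto simp: c_def)
  also have "\<dots> = (real (Suc K) * real (K choose Suc L)) * ?A + (real (Suc K) * real (K choose L)) * max_degree V X w k"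
    by (simp only: distrib_left mult.assoc)
  also have "\<dots> = c * (real (K - L) * ?A + real (Suc L) * max_degree V X w k)"
    unfolding c1 c2 by (simp only: distrib_left mult_ac)
  finally have "real (Suc K) * ?B \<le> real (K - L) * ?A + real (Suc L) * max_degree V X w k"
    using c by simp
  then show ?thesis using LK by (simp add: K L of_nat_diff algebra_simps)
qed

end
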